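(* There are elements $\alpha$ and $\beta$ of reduced norm $1$ in the algebra $D_B$ such that $\mathcal{Q}_B=O_K[\alpha,\beta]$ as an order, such that the group $\mathcal{Q}_B^1$ of elements of reduced norm $1$ in $\mathcal{Q}_B$ equals the group $\langle\alpha,\beta\rangle$ generated by $\alpha$ and $\beta$, and such that $\mathcal{Q}_B^1/\{\pm1\}$ is isomorphic to the triangle group $\Delta_{(3,3,4)}$.
   Context: $K=\mathbb{Q}(\sqrt2)$, $O_K=\mathbb{Z}[\sqrt2]$. $D_B$ is the quaternion algebra over $K$ with basis $1,i,j,ij$ and relations $i^2=-3$, $j^2=\sqrt2$, $ji=-ij$. Let $\alpha_0=\frac12(1+i)$ and $\gamma=\frac16(3+i)\bigl[1-(1+\sqrt2)j\bigr]$. The maximal order $\mathcal{Q}_B$ of $D_B$ is $\mathcal{Q}_B=O_K+O_K\alpha_0+O_K\gamma+O_K\alpha_0\gamma$. $O_K[\alpha,\beta]$ denotes the $O_K$-subalgebra of $D_B$ generated by $\alpha$ and $\beta$. $\Delta_{(3,3,4)}=\langle a,b\mid a^3=b^3=(ab)^4=1\rangle$. *)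

theory Defs
  imports Complex_Main "HOL-Algebra.Module" "HOL-Algebra.Coset"
    "HOL-Algebra.Generated_Groups" "HOL-Algebra.Subrings"
begin

section \<open>Quaternion algebras\<close>

text \<open>The tuple \<open>(x0, x1, x2, x3)\<close> stands for \<open>x0 + x1 i + x2 j + x3 ij\<close>, with coordinates in \<open>F\<close>.
  The product is the bilinear one determined by \<open>i\<^sup>2 = a\<close>, \<open>j\<^sup>2 = b\<close>, \<open>ji = -ij\<close>.\<close>

type_synonym 'a quat = "'a \<times> 'a \<times> 'a \<times> 'a"

fun quat_mult :: "'a::comm_ring_1 \<Rightarrow> 'a \<Rightarrow> 'a quat \<Rightarrow> 'a quat \<Rightarrow> 'a quat" where
  "quat_mult a b (x0, x1, x2, x3) (y0, y1, y2, y3) =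
    (x0 * y0 + a * x1 * y1 + b * x2 * y2 - a * b * x3 * y3,
     x0 * y1 + x1 * y0 - b * x2 * y3 + b * x3 * y2,
     x0 * y2 + x2 * y0 + a * x1 * y3 - a * x3 * y1,
     x0 * y3 + x3 * y0 + x1 * y2 - x2 * y1)"

fun quat_add :: "'a::comm_ring_1 quat \<Rightarrow> 'a quat \<Rightarrow> 'a quat" where
  "quat_add (x0, x1, x2, x3) (y0, y1, y2, y3) = (x0 + y0, x1 + y1, x2 + y2, x3 + y3)"

fun quat_smult :: "'a::comm_ring_1 \<Rightarrow> 'a quat \<Rightarrow> 'a quat" where
  "quat_smult c (x0, x1, x2, x3) = (c * x0, c * x1, c * x2, c * x3)"

definition quat_algebra :: "'a::comm_ring_1 set \<Rightarrow> 'a \<Rightarrow> 'a \<Rightarrow> ('a, 'a quat) module" where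
  "quat_algebra F a b =
    \<lparr>carrier = F \<times> F \<times> F \<times> F, monoid.mult = quat_mult a b, one = (1, 0, 0, 0),
     ring.zero = (0, 0, 0, 0), add = quat_add, smult = quat_smult\<rparr>"

fun quat_conj :: "'a::comm_ring_1 quat \<Rightarrow> 'a quat" where
  "quat_conj (x0, x1, x2, x3) = (x0, - x1, - x2, - x3)"

text \<open>The reduced norm of \<open>x\<close> is the scalar \<open>x * quat_conj x\<close>; see \<open>quat_mult_conj\<close>.\<close>

fun quat_nrd :: "'a::comm_ring_1 \<Rightarrow> 'a \<Rightarrow> 'a quat \<Rightarrow> 'a" where
  "quat_nrd a b (x0, x1, x2, x3) = x0\<^sup>2 - a * x1\<^sup>2 - b * x2\<^sup>2 + a * b * x3\<^sup>2"

lemma quat_mult_conj: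
  "quat_mult a b x (quat_conj x) = (quat_nrd a b x, 0, 0, 0)"
  "quat_mult a b (quat_conj x) x = (quat_nrd a b x, 0, 0, 0)"
  by (cases x; simp add: power2_eq_square algebra_simps)+

lemma quat_nrd_mult: "quat_nrd a b (quat_mult a b x y) = quat_nrd a b x * quat_nrd a b y"
  by (cases x; cases y) (simp add: power2_eq_square algebra_simps)

lemma quat_mult_assoc:
  "quat_mult a b (quat_mult a b x y) z = quat_mult a b x (quat_mult a b y z)"
  by (cases x; cases y; cases z) (simp add: algebra_simps)

lemma quat_relations:
  "quat_mult a b (0, 1, 0, 0) (0, 1, 0, 0) = (a, 0, 0, 0)"
  "quat_mult a b (0, 0, 1, 0) (0, 0, 1, 0) = (b, 0, 0, 0)"
  "quat_mult a b (0, 1, 0, 0) (0, 0, 1, 0) = (0, 0, 0, 1)"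
  "quat_mult a b (0, 0, 1, 0) (0, 1, 0, 0) = (0, 0, 0, - 1)"
  by simp_all

lemma ring_quat_algebra:
  assumes "a \<in> F" "b \<in> F" "0 \<in> F" "1 \<in> F"
    and plus: "\<And>x y. x \<in> F \<Longrightarrow> y \<in> F \<Longrightarrow> x + y \<in> F"
    and times: "\<And>x y. x \<in> F \<Longrightarrow> y \<in> F \<Longrightarrow> x * y \<in> F"
    and uminus: "\<And>x. x \<in> F \<Longrightarrow> - x \<in> F"
  shows "ring (quat_algebra F a b)"
proof -
  have minus: "x - y \<in> F" if "x \<in> F" "y \<in> F" for x y
    using plus[OF that(1) uminus[OF that(2)]] by simp
  show ?thesis
  proof (rule ringI)
    show "abelian_group (quat_algebra F a b)"
    proof (rule abelian_groupI)
      fix x assume "x \<in> carrier (quat_algebra F a b)"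
      then show "\<exists>y\<in>carrier (quat_algebra F a b).
          y \<oplus>\<^bsub>quat_algebra F a b\<^esub> x = \<zero>\<^bsub>quat_algebra F a b\<^esub>"
        by (intro bexI[of _ "quat_smult (-1) x"]) (auto simp: quat_algebra_def uminus)
    qed (auto simp: quat_algebra_def plus assms add_ac)
    show "monoid (quat_algebra F a b)"
      by unfold_locales
        (auto simp: quat_algebra_def plus times minus assms quat_mult_assoc simp del: quat_mult.simps,
          auto simp: plus times minus assms)
  qed (auto simp: quat_algebra_def algebra_simps)
qed


section \<open>Generated subalgebras and presented groups\<close>

text \<open>The \<open>S\<close>-subalgebra of \<open>R\<close> generated by \<open>X\<close>, for a ring \<open>S\<close> of scalars. Subalgebras contain
  the unit element of \<open>R\<close>.\<close>

definition generated_subalgebra ::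
    "'k set \<Rightarrow> ('k, 'a, 'm) module_scheme \<Rightarrow> 'a set \<Rightarrow> 'a set" where
  "generated_subalgebra S R X =
    \<Inter>{V. subring V R \<and> (\<forall>c\<in>S. \<forall>v\<in>V. c \<odot>\<^bsub>R\<^esub> v \<in> V) \<and> X \<subseteq> V}"

text \<open>Group words on the generators \<open>'g\<close>: the letter \<open>(g, True)\<close> is \<open>g\<close>, and \<open>(g, False)\<close> is its
  formal inverse. Two words represent the same element of the group presented by the relators
  \<open>R\<close> iff they are linked by insertions and deletions of relators and of cancelling pairs.\<close>

type_synonym 'g word = "('g \<times> bool) list"

inductive pres_eq :: "'g word set \<Rightarrow> 'g word \<Rightarrow> 'g word \<Rightarrow> bool" for R where
  refl: "pres_eq R u u"
| sym: "pres_eq R u v \<Longrightarrow> pres_eq R v u"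
| trans: "pres_eq R u v \<Longrightarrow> pres_eq R v w \<Longrightarrow> pres_eq R u w"
| cancel: "pres_eq R (u @ [(g, s), (g, \<not> s)] @ v) (u @ v)"
| relator: "r \<in> R \<Longrightarrow> pres_eq R (u @ r @ v) (u @ v)"

definition pres_rel :: "'g word set \<Rightarrow> 'g word rel" where
  "pres_rel R = {(u, v). pres_eq R u v}"

definition presented_group :: "'g word set \<Rightarrow> 'g word set monoid" where
  "presented_group R =
    \<lparr>carrier = UNIV // pres_rel R,
     monoid.mult = (\<lambda>X Y. \<Union>x\<in>X. \<Union>y\<in>Y. pres_rel R `` {x @ y}),
     one = pres_rel R `` {[]}\<rparr>"

lemma equiv_pres_rel: "equiv UNIV (pres_rel R)"
  by (auto simp: equiv_def refl_on_def sym_def trans_def pres_rel_def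
      intro: pres_eq.refl pres_eq.sym pres_eq.trans)

lemma pres_eq_context: "pres_eq R u v \<Longrightarrow> pres_eq R (p @ u @ q) (p @ v @ q)"
proof (induction rule: pres_eq.induct)
  case (cancel u g s v)
  show ?case using pres_eq.cancel[of R "p @ u" g s "v @ q"] by simp
next
  case (relator r u v)
  then show ?case using pres_eq.relator[of r R "p @ u" "v @ q"] by simp
qed (auto intro: pres_eq.refl pres_eq.sym pres_eq.trans)

lemma pres_eq_append: "pres_eq R u u' \<Longrightarrow> pres_eq R v v' \<Longrightarrow> pres_eq R (u @ v) (u' @ v')"
  using pres_eq_context[of R u u' "[]" v] pres_eq_context[of R v v' u' "[]"]
  by (auto intro: pres_eq.trans)

lemma presented_group_mult:
  "(pres_rel R `` {u}) \<otimes>\<^bsub>presented_group R\<^esub> (pres_rel R `` {v}) = pres_rel R `` {u @ v}"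
proof -
  have "pres_rel R `` {x @ y} = pres_rel R `` {u @ v}"
    if "pres_eq R u x" "pres_eq R v y" for x y
    using equiv_class_eq[OF equiv_pres_rel, of "u @ v" "x @ y" R] pres_eq_append[OF that]
    by (simp add: pres_rel_def)
  then show ?thesis
    by (auto simp: presented_group_def pres_rel_def intro: pres_eq.refl)
qed

lemma group_presented_group: "group (presented_group R)"
proof (rule groupI)
  fix x assume "x \<in> carrier (presented_group R)"
  then obtain u where x: "x = pres_rel R `` {u}"
    by (auto simp: presented_group_def quotient_def)
  define v where "v = rev (map (\<lambda>(g, s). (g, \<not> s)) u)"
  have "pres_eq R (rev (map (\<lambda>(g, s). (g, \<not> s)) u) @ u) []"
  proof (induction u)
    case (Cons l u)
    obtain g s where l: "l = (g, s)" by (cases l)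
    show ?case
      using pres_eq.cancel[of R "rev (map (\<lambda>(g, s). (g, \<not> s)) u)" g "\<not> s" u] Cons
      by (auto simp: l intro: pres_eq.trans)
  qed (simp add: pres_eq.refl)
  then have "pres_rel R `` {v @ u} = pres_rel R `` {[]}"
    using equiv_class_eq[OF equiv_pres_rel] by (simp add: pres_rel_def v_def)
  then have "(pres_rel R `` {v}) \<otimes>\<^bsub>presented_group R\<^esub> x = \<one>\<^bsub>presented_group R\<^esub>"
    unfolding x presented_group_mult by (simp add: presented_group_def)
  moreover have "pres_rel R `` {v} \<in> carrier (presented_group R)"
    by (auto simp: presented_group_def quotient_def)
  ultimately show "\<exists>y\<in>carrier (presented_group R).
      y \<otimes>\<^bsub>presented_group R\<^esub> x = \<one>\<^bsub>presented_group R\<^esub>" by blast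
next
  fix x y assume "x \<in> carrier (presented_group R)" "y \<in> carrier (presented_group R)"
  then obtain u v where "x = pres_rel R `` {u}" "y = pres_rel R `` {v}"
    by (auto simp: presented_group_def quotient_def)
  then have "x \<otimes>\<^bsub>presented_group R\<^esub> y = pres_rel R `` {u @ v}"
    by (simp only: presented_group_mult)
  then show "x \<otimes>\<^bsub>presented_group R\<^esub> y \<in> carrier (presented_group R)"
    by (auto simp: presented_group_def quotient_def)
next
  fix x y z assume "x \<in> carrier (presented_group R)" "y \<in> carrier (presented_group R)"
    "z \<in> carrier (presented_group R)"
  then obtain u v w where
    "x = pres_rel R `` {u}" "y = pres_rel R `` {v}" "z = pres_rel R `` {w}"
    by (auto simp: presented_group_def quotient_def)
  then show "x \<otimes>\<^bsub>presented_group R\<^esub> y \<otimes>\<^bsub>presented_group R\<^esub> z =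
      x \<otimes>\<^bsub>presented_group R\<^esub> (y \<otimes>\<^bsub>presented_group R\<^esub> z)"
    by (simp only: presented_group_mult append_assoc)
next
  fix x assume "x \<in> carrier (presented_group R)"
  then obtain u where x: "x = pres_rel R `` {u}"
    by (auto simp: presented_group_def quotient_def)
  have "\<one>\<^bsub>presented_group R\<^esub> = pres_rel R `` {[]}"
    by (simp add: presented_group_def)
  then show "\<one>\<^bsub>presented_group R\<^esub> \<otimes>\<^bsub>presented_group R\<^esub> x = x"
    by (simp only: x presented_group_mult append_Nil)
qed (auto simp: presented_group_def quotient_def)

datatype triangle_gen = Gen_a | Gen_b

definition triangle_group :: "nat \<Rightarrow> nat \<Rightarrow> nat \<Rightarrow> triangle_gen word set monoid" where
  "triangle_group p q r = presented_group
    {replicate p (Gen_a, True), replicate q (Gen_b, True),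
     concat (replicate r [(Gen_a, True), (Gen_b, True)])}"


section \<open>The algebra \<open>D_B\<close> and the order \<open>Q_B\<close>\<close>

definition K :: "real set" where
  "K = {of_rat p + of_rat q * sqrt 2 | p q. True}"

definition O_K :: "real set" where
  "O_K = {of_int m + of_int n * sqrt 2 | m n. True}"

definition D_B :: "(real, real quat) module" where
  "D_B = quat_algebra K (- 3) (sqrt 2)"

definition nrd :: "real quat \<Rightarrow> real" where
  "nrd = quat_nrd (- 3) (sqrt 2)"

definition alpha0 :: "real quat" where
  "alpha0 = (1 / 2) \<odot>\<^bsub>D_B\<^esub> (1, 1, 0, 0)"

definition gamma :: "real quat" where
  "gamma = (1 / 6) \<odot>\<^bsub>D_B\<^esub> ((3, 1, 0, 0) \<otimes>\<^bsub>D_B\<^esub> (1, 0, - (1 + sqrt 2), 0))"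

definition Q_B :: "real quat set" where
  "Q_B = {c0 \<odot>\<^bsub>D_B\<^esub> \<one>\<^bsub>D_B\<^esub> \<oplus>\<^bsub>D_B\<^esub> c1 \<odot>\<^bsub>D_B\<^esub> alpha0 \<oplus>\<^bsub>D_B\<^esub> c2 \<odot>\<^bsub>D_B\<^esub> gamma
      \<oplus>\<^bsub>D_B\<^esub> c3 \<odot>\<^bsub>D_B\<^esub> (alpha0 \<otimes>\<^bsub>D_B\<^esub> gamma) |
      c0 c1 c2 c3. c0 \<in> O_K \<and> c1 \<in> O_K \<and> c2 \<in> O_K \<and> c3 \<in> O_K}"

definition Q_B1 :: "real quat monoid" where
  "Q_B1 = (units_of D_B)\<lparr>carrier := {x \<in> Q_B. nrd x = 1}\<rparr>"

lemma K_closed: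
  shows "of_rat p \<in> K" and "sqrt 2 \<in> K"
    and "x \<in> K \<Longrightarrow> y \<in> K \<Longrightarrow> x + y \<in> K"
    and "x \<in> K \<Longrightarrow> y \<in> K \<Longrightarrow> x * y \<in> K"
    and "x \<in> K \<Longrightarrow> - x \<in> K"
proof -
  show "of_rat p \<in> K"
    unfolding K_def by (intro CollectI exI[of _ p] exI[of _ 0]) simp
  show "sqrt 2 \<in> K"
    unfolding K_def by (intro CollectI exI[of _ 0] exI[of _ 1]) simp
next
  assume "x \<in> K" "y \<in> K"
  then obtain p q p' q' where
    x: "x = of_rat p + of_rat q * sqrt 2" and y: "y = of_rat p' + of_rat q' * sqrt 2"
    by (auto simp: K_def)
  show "x + y \<in> K"
    unfolding K_def x y by (intro CollectI exI[of _ "p + p'"] exI[of _ "q + q'"])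
      (simp add: of_rat_add algebra_simps)
  have "sqrt 2 * (sqrt 2 * t) = 2 * t" for t :: real
    by (simp flip: mult.assoc)
  then show "x * y \<in> K"
    unfolding K_def x y
    by (intro CollectI exI[of _ "p * p' + 2 * q * q'"] exI[of _ "p * q' + q * p'"])
      (simp add: of_rat_add of_rat_mult algebra_simps)
next
  assume "x \<in> K"
  then obtain p q where x: "x = of_rat p + of_rat q * sqrt 2"
    by (auto simp: K_def)
  show "- x \<in> K"
    unfolding K_def x by (intro CollectI exI[of _ "- p"] exI[of _ "- q"]) (simp add: of_rat_minus)
qed

lemma ring_D_B: "ring D_B"
  unfolding D_B_def
  using K_closed(1)[of 0] K_closed(1)[of 1] K_closed(1)[of "- 3"]
  by (intro ring_quat_algebra) (auto simp: of_rat_minus intro: K_closed)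

end

theory Submission
  imports Defs "HOL-Computational_Algebra.Primes" "HOL-Analysis.Product_Vector"
begin

text \<open>Take \<open>\<alpha> = \<alpha>\<^sub>0\<close> and \<open>\<beta> = \<alpha>\<^sub>0 + (\<surd>2 - 1) \<alpha>\<^sub>0 \<gamma>\<close>. Both have reduced norm and reduced trace \<open>1\<close>, and
  \<open>\<alpha> \<beta>\<close> has reduced trace \<open>- \<surd>2\<close>, so \<open>\<alpha>\<^sup>3 = \<beta>\<^sup>3 = (\<alpha> \<beta>)\<^sup>4 = - 1\<close>. Since \<open>\<surd>2 - 1\<close> and \<open>\<alpha>\<^sub>0\<close> are
  units, \<open>\<gamma>\<close> can be recovered from \<open>\<alpha>\<close> and \<open>\<beta>\<close> over \<open>O\<^sub>K\<close>, which settles the statement about orders.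

  At the real place with \<open>\<surd>2 > 0\<close> the algebra splits, and the units of norm \<open>1\<close> act on the
  hyperbolic plane; at the other place it is definite, which makes this action discrete. The
  elements \<open>\<alpha>\<close>, \<open>\<beta>\<close>, \<open>\<alpha> \<beta>\<close> are rotations about the vertices \<open>P\<close>, \<open>Q\<close>, \<open>R\<close> of a triangle with angles
  \<open>\<pi>/3\<close>, \<open>\<pi>/3\<close>, \<open>\<pi>/4\<close>. Two things remain to be shown.

  \<^item> \<^emph>\<open>Generation\<close> (\<open>norm_one_units_subset_generated\<close>). Write \<open>y = z\<^sub>1 + z\<^sub>2 j\<close> with \<open>z\<^sub>1, z\<^sub>2\<close> in
    \<open>K(i)\<close>. The number \<open>N(z\<^sub>1)\<close> is \<open>cosh\<^sup>2 (d/2)\<close>, where \<open>d\<close> is the distance between \<open>P\<close> and \<open>y P\<close>. If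
    none of the six elements \<open>\<beta>\<^sup>\<plusminus>\<^sup>1 \<alpha>\<^sup>k\<close> decreases it, then \<open>y P\<close> lies in the hexagon formed by the
    six copies of the triangle around \<open>P\<close>, and \<open>N(z\<^sub>1) < 5/4\<close> (\<open>low_height\<close>). But \<open>3 N(z\<^sub>1)\<close> is
    an integer of \<open>K\<close> whose conjugate lies between \<open>0\<close> and \<open>3\<close>, and it is a norm from
    \<open>O\<^sub>K[\<alpha>\<^sub>0]\<close>. Only the values \<open>3\<close> and \<open>2 + \<surd>2\<close> are small enough, and the second is no norm
    because the prime \<open>\<surd>2\<close> is inert in \<open>K(i)\<close>. So \<open>N(z\<^sub>1) = 1\<close>, hence \<open>z\<^sub>2 = 0\<close>, and \<open>y\<close> is one of
    the six powers of \<open>\<alpha>\<close>. The height takes discrete values (\<open>height_gap\<close>), so descent applies.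

  \<^item> \<^emph>\<open>Presentation\<close> (\<open>trivial_action_imp_mirror_eq_Nil\<close>). The triangle group is the group of even
    words in the Coxeter group generated by the reflections \<open>r\<close>, \<open>s\<close>, \<open>t\<close> in the sides of the triangle,
    with \<open>a = r s\<close> and \<open>b = s t\<close>. Conjugation by the units on the pure quaternions is the
    geometric representation of that Coxeter group (\<open>letter_root_quat\<close>). By the argument of Tits, a
    word that acts trivially there is a consequence of the Coxeter relations: every word either
    maps a simple root to a positive root or can be rewritten, without becoming longer, to end in
    the corresponding reflection (\<open>root_positive_or_descends\<close>).\<close>

section \<open>Arithmetic of the order\<close>

lemma sqrt2_sqrt2 [simp]: "sqrt 2 * (sqrt 2 * x) = 2 * (x::real)"
  by (simp flip: mult.assoc)

abbreviation qmul :: "real quat \<Rightarrow> real quat \<Rightarrow> real quat" (infixl "\<star>" 70) where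
  "x \<star> y \<equiv> quat_mult (- 3) (sqrt 2) x y"

definition alpha :: "real quat" where "alpha = (1/2, 1/2, 0, 0)"
definition beta :: "real quat" where
  "beta = (1/2, (1 + 2 * sqrt 2) / 6, 0, - 1/3)"

text \<open>The element with coordinates \<open>c0, c1, c2, c3\<close> in the basis \<open>1, \<alpha>\<^sub>0, \<gamma>, \<alpha>\<^sub>0 \<gamma>\<close>; see
  \<open>order_elt_coordinates\<close>.\<close>
definition order_elt :: "real \<Rightarrow> real \<Rightarrow> real \<Rightarrow> real \<Rightarrow> real quat" where
  "order_elt c0 c1 c2 c3 = (c0 + c1 / 2 + c2 / 2, c1 / 2 + c2 / 6 + c3 / 3,
     - (1 + sqrt 2) * c2 / 2, - (1 + sqrt 2) * (c2 / 6 + c3 / 3))"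

lemma order_elt_coordinates:
  "c0 \<odot>\<^bsub>D_B\<^esub> \<one>\<^bsub>D_B\<^esub> \<oplus>\<^bsub>D_B\<^esub> c1 \<odot>\<^bsub>D_B\<^esub> alpha0 \<oplus>\<^bsub>D_B\<^esub> c2 \<odot>\<^bsub>D_B\<^esub> gamma
    \<oplus>\<^bsub>D_B\<^esub> c3 \<odot>\<^bsub>D_B\<^esub> (alpha0 \<otimes>\<^bsub>D_B\<^esub> gamma) = order_elt c0 c1 c2 c3"
  by (simp add: alpha0_def gamma_def D_B_def quat_algebra_def order_elt_def field_simps)

lemma Q_B_eq: "Q_B = {order_elt c0 c1 c2 c3 | c0 c1 c2 c3.
    c0 \<in> O_K \<and> c1 \<in> O_K \<and> c2 \<in> O_K \<and> c3 \<in> O_K}"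
  by (simp add: Q_B_def order_elt_coordinates)

text \<open>The graph of the conjugation \<open>\<surd>2 \<mapsto> - \<surd>2\<close> on \<open>O\<^sub>K\<close>. As a relation between real numbers it can be
  transported through polynomial expressions without choosing coordinates.\<close>
definition galois_pair :: "real \<Rightarrow> real \<Rightarrow> bool" where
  "galois_pair x x' \<longleftrightarrow> (\<exists>m n. x = of_int m + of_int n * sqrt 2 \<and> x' = of_int m - of_int n * sqrt 2)"

lemma O_K_galois: "x \<in> O_K \<longleftrightarrow> (\<exists>x'. galois_pair x x')"
  by (auto simp: O_K_def galois_pair_def)

lemma galois_pair_add:
  assumes "galois_pair x x'" "galois_pair y y'"
  shows "galois_pair (x + y) (x' + y')"
proof -
  obtain m n p q where
    "x = of_int m + of_int n * sqrt 2" "x' = of_int m - of_int n * sqrt 2"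
    "y = of_int p + of_int q * sqrt 2" "y' = of_int p - of_int q * sqrt 2"
    using assms by (auto simp: galois_pair_def)
  then have "x + y = of_int (m + p) + of_int (n + q) * sqrt 2"
    "x' + y' = of_int (m + p) - of_int (n + q) * sqrt 2"
    by (simp_all add: distrib_right)
  then show ?thesis unfolding galois_pair_def by blast
qed

lemma galois_pair_mult:
  assumes "galois_pair x x'" "galois_pair y y'"
  shows "galois_pair (x * y) (x' * y')"
proof -
  obtain m n p q where
    "x = of_int m + of_int n * sqrt 2" "x' = of_int m - of_int n * sqrt 2"
    "y = of_int p + of_int q * sqrt 2" "y' = of_int p - of_int q * sqrt 2"
    using assms by (auto simp: galois_pair_def)
  then have "x * y = of_int (m * p + 2 * n * q) + of_int (m * q + n * p) * sqrt 2"
    "x' * y' = of_int (m * p + 2 * n * q) - of_int (m * q + n * p) * sqrt 2"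
    by (simp_all only: of_int_add of_int_mult) (simp_all add: algebra_simps)
  then show ?thesis unfolding galois_pair_def by blast
qed

lemma galois_pair_of_int: "galois_pair (of_int m) (of_int m)"
  unfolding galois_pair_def by (intro exI[of _ m] exI[of _ 0]) simp

lemma galois_pair_numeral: "galois_pair (numeral k) (numeral k)" "galois_pair 1 1" "galois_pair 0 0"
  using galois_pair_of_int[of "numeral k"] galois_pair_of_int[of 1] galois_pair_of_int[of 0] by simp_all

lemma galois_pair_sqrt2: "galois_pair (sqrt 2) (- sqrt 2)"
  unfolding galois_pair_def by (intro exI[of _ 0] exI[of _ 1]) simp

lemma galois_pair_minus: "galois_pair x x' \<Longrightarrow> galois_pair (- x) (- x')"
  using galois_pair_mult[OF galois_pair_of_int[of "-1"]] by simp

lemma galois_pair_diff: "galois_pair x x' \<Longrightarrow> galois_pair y y' \<Longrightarrow> galois_pair (x - y) (x' - y')"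
  using galois_pair_add[OF _ galois_pair_minus] by simp

lemmas galois_pair_intros = galois_pair_add galois_pair_mult galois_pair_numeral galois_pair_sqrt2
  galois_pair_minus galois_pair_diff

lemma O_K_closed:
  "x \<in> O_K \<Longrightarrow> y \<in> O_K \<Longrightarrow> x + y \<in> O_K" "x \<in> O_K \<Longrightarrow> y \<in> O_K \<Longrightarrow> x * y \<in> O_K"
  "x \<in> O_K \<Longrightarrow> - x \<in> O_K" "x \<in> O_K \<Longrightarrow> y \<in> O_K \<Longrightarrow> x - y \<in> O_K"
  "0 \<in> O_K" "1 \<in> O_K" "numeral k \<in> O_K" "sqrt 2 \<in> O_K"
  unfolding O_K_galois by (blast intro: galois_pair_intros)+

lemma sqrt2_independent:
  assumes "of_int m + of_int n * sqrt 2 = (0::real)"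
  shows "m = 0 \<and> n = 0"
proof -
  have "(of_int m :: real)\<^sup>2 = (of_int n * sqrt 2)\<^sup>2"
    using assms by (simp add: add_eq_0_iff2 power2_eq_square)
  then have eq: "m\<^sup>2 = 2 * n\<^sup>2"
    by (simp add: power_mult_distrib flip: of_int_power)
  have "n = 0"
  proof (rule ccontr)
    assume n: "n \<noteq> 0"
    with eq have m: "m \<noteq> 0" by auto
    \<comment> \<open>The multiplicity of \<open>2\<close> is even on the left and odd on the right.\<close>
    have "multiplicity 2 (m\<^sup>2) = multiplicity 2 (2 * n\<^sup>2)" by (simp add: eq)
    with m n show False
      by (simp add: prime_elem_multiplicity_power_distrib prime_elem_multiplicity_mult_distrib) presburger
  qed
  with eq show ?thesis by simp
qed

lemma sqrt2_coeffs:
  assumes "of_int m + of_int n * sqrt 2 = of_int m' + of_int n' * sqrt 2"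
  shows "m = m'" "n = n'"
  using sqrt2_independent[of "m - m'" "n - n'"] assms by (auto simp: algebra_simps)

lemma galois_pair_unique: "galois_pair x y \<Longrightarrow> galois_pair x z \<Longrightarrow> y = z"
  unfolding galois_pair_def using sqrt2_coeffs by metis

text \<open>The structure constants of the order follow from \<open>\<alpha>\<^sub>0\<^sup>2 = \<alpha>\<^sub>0 - 1\<close>, \<open>\<gamma>\<^sup>2 = \<gamma> + (1 + \<surd>2)\<close> and
  \<open>\<gamma> \<alpha>\<^sub>0 = - 1 + \<alpha>\<^sub>0 + \<gamma> - \<alpha>\<^sub>0 \<gamma>\<close>.\<close>
lemma order_elt_mult:
  "order_elt c0 c1 c2 c3 \<star> order_elt d0 d1 d2 d3 =
    order_elt (c0 * d0 - c1 * d1 - d1 * (c2 + c3) + (1 + sqrt 2) * (c2 * (d2 + d3) + c3 * d3))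
      (c0 * d1 + c1 * d0 + c1 * d1 + d1 * c2 + (1 + sqrt 2) * (c3 * d2 - c2 * d3))
      (c0 * d2 - c1 * d3 + c2 * (d0 + d1) + c3 * d1 + c2 * (d2 + d3) + c3 * d3 - d3 * (c2 + c3))
      (c0 * d3 + c1 * d2 + c1 * d3 + c3 * d0 - c2 * d1 + c3 * d2 - c2 * d3 + d3 * c2)"
  by (simp add: order_elt_def field_simps)

text \<open>The norm form of \<open>O\<^sub>K[\<alpha>\<^sub>0]\<close> over \<open>O\<^sub>K\<close>: the value at \<open>(u, v)\<close> is the norm of \<open>u + v \<alpha>\<^sub>0\<close>.\<close>
abbreviation eisenstein :: "'a::comm_ring_1 \<Rightarrow> 'a \<Rightarrow> 'a" where
  "eisenstein u v \<equiv> u\<^sup>2 + u * v + v\<^sup>2"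

lemma eisenstein_nonneg: "0 \<le> eisenstein u (v::real)"
proof -
  have "eisenstein u v = (u + v/2)\<^sup>2 + 3/4 * v\<^sup>2" by (simp add: power2_eq_square field_simps)
  then show ?thesis by simp
qed

text \<open>The height of \<open>z\<^sub>1 + z\<^sub>2 j\<close> is the norm of \<open>z\<^sub>1\<close>.\<close>
fun height :: "real quat \<Rightarrow> real" where
  "height (x0, x1, x2, x3) = x0\<^sup>2 + 3 * x1\<^sup>2"

text \<open>The coordinate \<open>z\<^sub>1\<close> of an element of the order lies in \<open>O\<^sub>K[\<alpha>\<^sub>0] / \<surd>-3\<close>, whence the factor \<open>3\<close>.\<close>
lemma height_order_elt:
  "3 * height (order_elt c0 c1 c2 c3) = eisenstein (- c0 - 2 * c1 - c2 - c3) (2 * c0 + c1 + c2)"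
  by (simp add: order_elt_def field_simps power2_eq_square)

text \<open>The coefficient \<open>4 + 3 \<surd>2\<close> is \<open>\<surd>2 (1 + \<surd>2)\<^sup>2\<close>; the unit \<open>1 + \<surd>2\<close> comes from \<open>\<gamma>\<close>.\<close>
lemma nrd_order_elt:
  "3 * nrd (order_elt c0 c1 c2 c3) = 3 * height (order_elt c0 c1 c2 c3)
     - (4 + 3 * sqrt 2) * eisenstein c2 c3"
  by (simp add: nrd_def order_elt_def field_simps power2_eq_square)

lemma eisenstein_conj:
  "galois_pair u u' \<Longrightarrow> galois_pair v v' \<Longrightarrow> galois_pair (eisenstein u v) (eisenstein u' v')"
  unfolding power2_eq_square by (intro galois_pair_intros)

section \<open>The height of a unit of norm one\<close>

definition norm_one_units :: "real quat set" where "norm_one_units = {x \<in> Q_B. nrd x = 1}"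

text \<open>At the identity place the norm equation \<open>N(z\<^sub>1) - \<surd>2 N(z\<^sub>2) = 1\<close> forces the height to be at least
  \<open>1\<close>. At the conjugate place the sign of \<open>\<surd>2\<close> changes, the form becomes definite, and the conjugate of
  the height is at most \<open>1\<close>.\<close>
lemma height_integral:
  assumes "y \<in> norm_one_units"
  obtains c0 c1 c2 c3 v v' where "c0 \<in> O_K" "c1 \<in> O_K" "c2 \<in> O_K" "c3 \<in> O_K"
    "y = order_elt c0 c1 c2 c3" "3 * height y = v" "galois_pair v v'" "3 \<le> v" "0 \<le> v'" "v' \<le> 3"
proof -
  obtain c0 c1 c2 c3 where y: "y = order_elt c0 c1 c2 c3"
    and c: "c0 \<in> O_K" "c1 \<in> O_K" "c2 \<in> O_K" "c3 \<in> O_K"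
    using assms by (auto simp: norm_one_units_def Q_B_eq)
  then obtain d0 d1 d2 d3 where d: "galois_pair c0 d0" "galois_pair c1 d1" "galois_pair c2 d2" "galois_pair c3 d3"
    by (auto simp: O_K_galois)
  define v where "v = eisenstein (- c0 - 2 * c1 - c2 - c3) (2 * c0 + c1 + c2)"
  define v' where "v' = eisenstein (- d0 - 2 * d1 - d2 - d3) (2 * d0 + d1 + d2)"
  have v: "galois_pair v v'" unfolding v_def v'_def by (intro eisenstein_conj galois_pair_intros d)
  have h: "3 * height y = v" by (simp only: y height_order_elt v_def)
  have n: "v - (4 + 3 * sqrt 2) * eisenstein c2 c3 = 3"
    using assms nrd_order_elt[of c0 c1 c2 c3] h by (simp add: norm_one_units_def y)
  \<comment> \<open>Conjugating the norm equation.\<close>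
  have "galois_pair (v - (4 + 3 * sqrt 2) * eisenstein c2 c3) (v' - (4 + 3 * - sqrt 2) * eisenstein d2 d3)"
    by (intro eisenstein_conj galois_pair_intros d v)
  with n have "v' - (4 + 3 * - sqrt 2) * eisenstein d2 d3 = 3"
    using galois_pair_unique galois_pair_numeral(1) by metis
  moreover have "4 < 3 * sqrt 2"
    by (rule power2_less_imp_less) (simp_all add: power_mult_distrib)
  then have "(3 * sqrt 2 - 4) * eisenstein d2 d3 \<ge> 0" by (intro mult_nonneg_nonneg eisenstein_nonneg) simp
  ultimately have "v' \<le> 3" by (simp add: algebra_simps)
  moreover have "3 \<le> v"
  proof -
    have "(4 + 3 * sqrt 2) * eisenstein c2 c3 \<ge> 0" by (intro mult_nonneg_nonneg eisenstein_nonneg) simp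
    with n show ?thesis by linarith
  qed
  moreover have "0 \<le> v'" unfolding v'_def by (rule eisenstein_nonneg)
  ultimately show ?thesis using that c y h v by blast
qed

text \<open>The difference of two values of \<open>3 N(z\<^sub>1)\<close> times its conjugate is a nonzero rational integer, and
  the conjugate is at most \<open>3\<close> in absolute value. So different heights differ by at least \<open>1/9\<close>, and
  \<open>\<lfloor>9 N(z\<^sub>1)\<rfloor>\<close> can serve as a measure for descent.\<close>
lemma height_gap:
  assumes "y \<in> norm_one_units" "z \<in> norm_one_units" "height z < height y"
  shows "9 * height z + 1 \<le> 9 * height y"
proof -
  obtain v v' where v: "3 * height y = v" "galois_pair v v'" "0 \<le> v'" "v' \<le> 3"
    using height_integral[OF assms(1)] by blast
  obtain w w' where w: "3 * height z = w" "galois_pair w w'" "0 \<le> w'" "w' \<le> 3"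
    using height_integral[OF assms(2)] by blast
  have "galois_pair (v - w) (v' - w')" using v w by (intro galois_pair_intros)
  then obtain m n where mn: "v - w = of_int m + of_int n * sqrt 2" "v' - w' = of_int m - of_int n * sqrt 2"
    by (auto simp: galois_pair_def)
  have prod: "(v - w) * (v' - w') = of_int (m\<^sup>2 - 2 * n\<^sup>2)"
    unfolding mn by (simp add: power2_eq_square algebra_simps)
  have "v - w > 0" using v w assms by simp
  have "v' - w' \<noteq> 0"
  proof
    assume "v' - w' = 0"
    then have "of_int m + of_int (- n) * sqrt 2 = (0::real)" using mn by simp
    from sqrt2_independent[OF this] mn \<open>v - w > 0\<close> show False by simp
  qed
  with \<open>v - w > 0\<close> have "m\<^sup>2 - 2 * n\<^sup>2 \<noteq> 0" using prod
    by (metis less_irrefl mult_eq_0_iff of_int_0)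
  then have "1 \<le> \<bar>m\<^sup>2 - 2 * n\<^sup>2\<bar>" by linarith
  then have "1 \<le> \<bar>(v - w) * (v' - w')\<bar>" unfolding prod by (simp only: flip: of_int_abs)
  also have "\<dots> = (v - w) * \<bar>v' - w'\<bar>" using \<open>v - w > 0\<close> by (simp add: abs_mult)
  also have "\<dots> \<le> (v - w) * 3" using v w \<open>v - w > 0\<close> by (intro mult_left_mono) auto
  finally show ?thesis using v w by simp
qed

text \<open>The form \<open>u\<^sup>2 + u v + v\<^sup>2\<close> is anisotropic over the residue field of \<open>\<surd>2\<close>. If \<open>\<surd>2\<close> divides a value,
  it therefore divides both arguments, and the value is divisible by \<open>2\<close>.\<close>
lemma eisenstein_neq_prime_over_2:
  assumes "u \<in> O_K" "v \<in> O_K"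
  shows "eisenstein u v \<noteq> 2 + sqrt 2"
proof
  assume eq: "eisenstein u v = 2 + sqrt 2"
  obtain a b c d :: int where u: "u = of_int a + of_int b * sqrt 2" and v: "v = of_int c + of_int d * sqrt 2"
    using assms by (auto simp: O_K_def)
  have "of_int (eisenstein a c + 2 * eisenstein b d) + of_int (2 * a * b + a * d + b * c + 2 * c * d) * sqrt 2
     = (of_int 2 + of_int 1 * sqrt 2 :: real)"
    using eq unfolding u v by (simp add: power2_eq_square algebra_simps)
  from sqrt2_coeffs[OF this] have 1: "eisenstein a c + 2 * eisenstein b d = 2"
    and 2: "2 * a * b + a * d + b * c + 2 * c * d = 1" by auto
  from 1 have "eisenstein a c = 2 * (1 - eisenstein b d)" by simp
  then have "even (eisenstein a c)" by simp
  then have "even a" "even c" by auto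
  then have "even (2 * a * b + a * d + b * c + 2 * c * d)" by simp
  with 2 show False by simp
qed

lemma eisenstein_eq_1:
  fixes a c :: int
  assumes "eisenstein a c = 1"
  shows "(a, c) \<in> {(1, 0), (-1, 0), (0, 1), (0, -1), (1, -1), (-1, 1)}"
proof -
  have *: "\<bar>x\<bar> \<le> 1" if "eisenstein x y = 1" for x y :: int
  proof -
    have "4 * eisenstein x y = (2 * y + x)\<^sup>2 + 3 * x\<^sup>2" by (simp add: power2_eq_square algebra_simps)
    then have "3 * x\<^sup>2 \<le> 4" using that by (smt (verit) zero_le_power2)
    then have "x\<^sup>2 < 2\<^sup>2" by simp
    then show ?thesis using power2_less_imp_less[of "\<bar>x\<bar>" 2] by simp
  qed
  have "a \<in> {-1, 0, 1}" "c \<in> {-1, 0, 1}"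
    using *[of a c] *[of c a] assms by (auto simp: algebra_simps)
  then show ?thesis using assms by auto
qed

text \<open>The rational part of the equation is a sum of positive definite integral forms, so the
  coefficients of \<open>\<surd>2\<close> vanish.\<close>
lemma eisenstein_unit:
  assumes "u \<in> O_K" "v \<in> O_K" "eisenstein u v = 1"
  shows "(u, v) \<in> {(1, 0), (-1, 0), (0, 1), (0, -1), (1, -1), (-1, 1)}"
proof -
  obtain a b c d :: int where u: "u = of_int a + of_int b * sqrt 2" and v: "v = of_int c + of_int d * sqrt 2"
    using assms by (auto simp: O_K_def)
  have "of_int (eisenstein a c + 2 * eisenstein b d) + of_int (2 * a * b + a * d + b * c + 2 * c * d) * sqrt 2
     = (of_int 1 + of_int 0 * sqrt 2 :: real)"
    using assms(3) unfolding u v by (simp add: power2_eq_square algebra_simps)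
  from sqrt2_coeffs[OF this] have 1: "eisenstein a c + 2 * eisenstein b d = 1" by auto
  have nonneg: "0 \<le> eisenstein x y" for x y :: int
    using eisenstein_nonneg[of "of_int x" "of_int y"]
    by (simp flip: of_int_power of_int_mult of_int_add)
  have split: "x = 1 \<and> z = 0" if "x + 2 * z = 1" "0 \<le> x" "0 \<le> z" for x z :: int
    using that by presburger
  have "eisenstein b d = 0" and ac: "eisenstein a c = 1"
    using split[OF 1 nonneg nonneg] by auto
  have "4 * eisenstein b d = (2 * b + d)\<^sup>2 + 3 * d\<^sup>2" "4 * eisenstein b d = (2 * d + b)\<^sup>2 + 3 * b\<^sup>2"
    by (simp_all add: power2_eq_square algebra_simps)
  with \<open>eisenstein b d = 0\<close> have "b = 0" "d = 0"
    by (smt (verit) zero_le_power2 zero_less_power2)+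
  with eisenstein_eq_1[OF ac] show ?thesis by (auto simp: u v)
qed

section \<open>Descent of the height\<close>

text \<open>The three inequalities for \<open>M\<close> put the point with coordinates \<open>a, b, c\<close> into a hexagon with
  threefold symmetry that is also symmetric under permuting the coordinates, and the conclusion
  bounds its distance from the centre. By symmetry it suffices to treat the chamber
  \<open>a \<ge> b \<ge> c\<close>, where the inequality that starts with \<open>e * a\<close> alone bounds both nonnegative coordinates \<open>s\<close> and \<open>t\<close>.\<close>
lemma hexagon_bound:
  fixes a b c e M :: real
  assumes "a + b + c = 0" "19/5 \<le> e"
    and "e * a + \<bar>b - c\<bar> \<le> M" "e * b + \<bar>c - a\<bar> \<le> M" "e * c + \<bar>a - b\<bar> \<le> M"
  shows "23 * (a\<^sup>2 + b\<^sup>2 + c\<^sup>2) \<le> 3 * M\<^sup>2"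
proof -
  have sorted: "23 * (a\<^sup>2 + b\<^sup>2 + c\<^sup>2) \<le> 3 * M\<^sup>2"
    if "a + b + c = 0" "e * a + \<bar>b - c\<bar> \<le> M" "b \<le> a" "c \<le> b" for a b c
  proof -
    define s t where "s = (a - b) / 3" and "t = (b - c) / 3"
    have st: "0 \<le> s" "0 \<le> t" using that by (auto simp: s_def t_def)
    have a: "a = 2 * s + t" and b: "b = t - s" and c: "c = - s - 2 * t"
      using that(1) by (simp_all add: s_def t_def field_simps)
    \<comment> \<open>With \<open>e\<close> replaced by \<open>19/5\<close> the coefficients are \<open>2 e\<close> and \<open>e + 3\<close>, and \<open>46 < (34/5)\<^sup>2\<close>.\<close>
    have "0 \<le> a" using st a by simp
    then have "19/5 * a \<le> e * a" using assms(2) by (intro mult_right_mono)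
    then have "38/5 * s + 34/5 * t \<le> M" using that(2) st unfolding a b c by (simp add: abs_if)
    then have "(38/5 * s + 34/5 * t)\<^sup>2 \<le> M\<^sup>2" using st by (intro power_mono) auto
    moreover have "46 * (s\<^sup>2 + s * t + t\<^sup>2) \<le> (38/5 * s + 34/5 * t)\<^sup>2"
    proof -
      have "(38/5 * s + 34/5 * t)\<^sup>2 - 46 * (s\<^sup>2 + s * t + t\<^sup>2) = 294/25 * s\<^sup>2 + 1434/25 * (s * t) + 6/25 * t\<^sup>2"
        by (simp add: power2_eq_square algebra_simps)
      also have "\<dots> \<ge> 0" using st by simp
      finally show ?thesis by simp
    qed
    moreover have "a\<^sup>2 + b\<^sup>2 + c\<^sup>2 = 6 * (s\<^sup>2 + s * t + t\<^sup>2)"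
      unfolding a b c by (simp add: power2_eq_square algebra_simps)
    ultimately show ?thesis by simp
  qed
  consider "b \<le> a" "c \<le> b" | "c \<le> a" "b \<le> c" | "a \<le> b" "c \<le> a" | "c \<le> b" "a \<le> c"
    | "a \<le> c" "b \<le> a" | "b \<le> c" "a \<le> b" by linarith
  then show ?thesis
  proof cases
    case 1
    then show ?thesis using sorted[of a b c] assms by simp
  next
    case 2
    then show ?thesis using sorted[of a c b] assms by (simp add: abs_minus_commute)
  next
    case 3
    then show ?thesis using sorted[of b a c] assms by (simp add: abs_minus_commute)
  next
    case 4
    then show ?thesis using sorted[of b c a] assms by simp
  next
    case 5
    then show ?thesis using sorted[of c a b] assms by simp
  next
    case 6
    then show ?thesis using sorted[of c b a] assms by (simp add: abs_minus_commute)
  qed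
qed

text \<open>The real and the imaginary coordinate of the product \<open>z\<^sub>1 z\<^sub>2\<close> in \<open>K(i)\<close>. They are the mixed terms in
  the height of \<open>\<beta>\<^sup>\<plusminus>\<^sup>1 (z\<^sub>1 + z\<^sub>2 j)\<close>.\<close>
fun zprod_re :: "real quat \<Rightarrow> real" where
  "zprod_re (x0, x1, x2, x3) = x0 * x2 - 3 * x1 * x3"

fun zprod_im :: "real quat \<Rightarrow> real" where
  "zprod_im (x0, x1, x2, x3) = x0 * x3 + x1 * x2"

lemma height_beta:
  "3 * height (beta \<star> y) = 3 * height y + sqrt 2 * (2 * height y - nrd y
      - (1 + 2 * sqrt 2) * zprod_re y - 3 * zprod_im y)"
  "3 * height (quat_conj beta \<star> y) = 3 * height y + sqrt 2 * (2 * height y - nrd y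
      - (1 + 2 * sqrt 2) * zprod_re y + 3 * zprod_im y)"
  by (cases y; simp add: nrd_def beta_def power2_eq_square field_simps)+

text \<open>Left multiplication by \<open>\<alpha>\<close> multiplies both \<open>z\<^sub>1\<close> and \<open>z\<^sub>2\<close> by a primitive sixth root of unity. It fixes
  the height and rotates \<open>z\<^sub>1 z\<^sub>2\<close> by a third of a turn.\<close>
lemma height_zprod_alpha:
  "height (alpha \<star> y) = height y"
  "zprod_re (alpha \<star> y) = - zprod_re y / 2 - 3 * zprod_im y / 2"
  "zprod_im (alpha \<star> y) = zprod_re y / 2 - zprod_im y / 2"
  by (cases y; simp add: alpha_def power2_eq_square field_simps)+

lemma nrd_mult: "nrd (x \<star> y) = nrd x * nrd y"
  by (simp add: nrd_def quat_nrd_mult)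

lemma nrd_alpha: "nrd alpha = 1" and nrd_beta: "nrd beta = 1"
  by (simp_all add: nrd_def alpha_def beta_def power2_eq_square field_simps)

text \<open>The hypothesis says that \<open>y P\<close> is at least as close to \<open>P\<close> as to the six points
  \<open>\<alpha>\<^sup>-\<^sup>k \<beta>\<^sup>\<plusminus>\<^sup>1 P\<close>. It gives six linear inequalities for \<open>z\<^sub>1 z\<^sub>2\<close>, which is thus confined to a hexagon of
  size proportional to \<open>M = N(z\<^sub>1) + \<surd>2 N(z\<^sub>2)\<close>. On the other hand \<open>N(z\<^sub>1 z\<^sub>2)\<close> is the product of
  \<open>N(z\<^sub>1)\<close> and \<open>N(z\<^sub>2)\<close>, so that \<open>4 \<surd>2 N(z\<^sub>1 z\<^sub>2) = M\<^sup>2 - 1\<close>, and the hexagon is too small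
  for this to hold with large \<open>M\<close>. The constant \<open>5/4\<close> lies below \<open>(3 + \<surd>2) / 3\<close>,
  the next value after \<open>1\<close> and \<open>(2 + \<surd>2) / 3\<close> that integrality permits.\<close>
lemma low_height:
  assumes "nrd y = 1"
    and "\<And>b a. b \<in> {beta, quat_conj beta} \<Longrightarrow>
      a \<in> {y, alpha \<star> y, alpha \<star> (alpha \<star> y)} \<Longrightarrow> height y \<le> height (b \<star> a)"
  shows "height y < 5/4"
proof -
  define M where "M = 2 * height y - 1"
  define e where "e = 1 + 2 * sqrt 2"
  have bound: "e * zprod_re a + \<bar>3 * zprod_im a\<bar> \<le> M"
    if "a \<in> {y, alpha \<star> y, alpha \<star> (alpha \<star> y)}" for a
  proof -
    have a: "nrd a = 1" "height a = height y" using that assms(1)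
      by (auto simp: nrd_mult nrd_alpha height_zprod_alpha)
    have "0 \<le> sqrt 2 * (M - e * zprod_re a - 3 * zprod_im a)"
      using height_beta(1)[of a] assms(2)[OF _ that, of beta] by (simp add: a M_def e_def)
    moreover have "0 \<le> sqrt 2 * (M - e * zprod_re a + 3 * zprod_im a)"
      using height_beta(2)[of a] assms(2)[OF _ that, of "quat_conj beta"] by (simp add: a M_def e_def)
    ultimately show ?thesis by (simp add: zero_le_mult_iff abs_if)
  qed
  define X Y where "X = zprod_re y" and "Y = zprod_im y"
  have "23 * (X\<^sup>2 + (- X/2 - 3*Y/2)\<^sup>2 + (- X/2 + 3*Y/2)\<^sup>2) \<le> 3 * M\<^sup>2"
  proof (rule hexagon_bound[of _ _ _ e])
    show "19/5 \<le> e"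
    proof -
      have "7/5 \<le> sqrt 2" by (rule real_le_rsqrt) (simp add: power2_eq_square)
      then show ?thesis by (simp add: e_def)
    qed
    show "e * X + \<bar>(- X/2 - 3*Y/2) - (- X/2 + 3*Y/2)\<bar> \<le> M"
      using bound[of y] by (simp add: X_def Y_def)
    have "zprod_re (alpha \<star> y) = - X/2 - 3*Y/2" "3 * zprod_im (alpha \<star> y) = X - (- X/2 + 3*Y/2)"
      by (simp_all add: height_zprod_alpha X_def Y_def)
    then show "e * (- X/2 - 3*Y/2) + \<bar>(- X/2 + 3*Y/2) - X\<bar> \<le> M"
      using bound[of "alpha \<star> y"] by (simp add: abs_minus_commute)
    have "zprod_re (alpha \<star> (alpha \<star> y)) = - X/2 + 3*Y/2"
      "3 * zprod_im (alpha \<star> (alpha \<star> y)) = (- X/2 - 3*Y/2) - X"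
      by (simp_all add: height_zprod_alpha X_def Y_def field_simps)
    then show "e * (- X/2 + 3*Y/2) + \<bar>X - (- X/2 - 3*Y/2)\<bar> \<le> M"
      using bound[of "alpha \<star> (alpha \<star> y)"] by (simp add: abs_minus_commute)
  qed simp
  then have 1: "23 * (X\<^sup>2 + 3 * Y\<^sup>2) \<le> 2 * M\<^sup>2" by (simp add: power2_eq_square field_simps)
  have 2: "4 * sqrt 2 * (X\<^sup>2 + 3 * Y\<^sup>2) = M\<^sup>2 - 1"
  proof -
    obtain x0 x1 x2 x3 where y: "y = (x0, x1, x2, x3)" by (cases y)
    have n: "sqrt 2 * (x2\<^sup>2 + 3 * x3\<^sup>2) = height y - 1"
      using assms(1) by (simp add: y nrd_def algebra_simps)
    have "X\<^sup>2 + 3 * Y\<^sup>2 = height y * (x2\<^sup>2 + 3 * x3\<^sup>2)"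
      by (simp add: X_def Y_def y power2_eq_square algebra_simps)
    then have "4 * sqrt 2 * (X\<^sup>2 + 3 * Y\<^sup>2) = 4 * height y * (sqrt 2 * (x2\<^sup>2 + 3 * x3\<^sup>2))" by simp
    also have "\<dots> = M\<^sup>2 - 1" unfolding n M_def by (simp add: power2_eq_square algebra_simps)
    finally show ?thesis .
  qed
  have "sqrt 2 \<le> 3/2" by (rule real_le_lsqrt) (simp_all add: power2_eq_square)
  then have "4 * sqrt 2 * (X\<^sup>2 + 3 * Y\<^sup>2) \<le> 6 * (X\<^sup>2 + 3 * Y\<^sup>2)" by (intro mult_right_mono) auto
  with 1 2 have "M\<^sup>2 < (3/2)\<^sup>2" by (simp add: power2_eq_square)
  then have "M < 3/2" by (rule power2_less_imp_less) simp
  then show ?thesis by (simp add: M_def)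
qed

text \<open>Write \<open>3 N(z\<^sub>1) = m + n \<surd>2\<close>. The bounds on this number and its conjugate leave only the values \<open>3\<close>
  and \<open>2 + \<surd>2\<close>, and the second is not a norm.\<close>
lemma low_height_imp_root_of_unity:
  assumes "y \<in> norm_one_units" "height y < 5/4"
  shows "y \<in> {order_elt 1 0 0 0, order_elt (-1) 0 0 0, order_elt 0 1 0 0, order_elt 0 (-1) 0 0,
      order_elt 1 (-1) 0 0, order_elt (-1) 1 0 0}"
proof -
  obtain c0 c1 c2 c3 v v' where c: "c0 \<in> O_K" "c1 \<in> O_K" "c2 \<in> O_K" "c3 \<in> O_K"
    and y: "y = order_elt c0 c1 c2 c3" and v: "3 * height y = v" "galois_pair v v'" "3 \<le> v" "0 \<le> v'" "v' \<le> 3"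
    using height_integral[OF assms(1)] by metis
  obtain m n where mn: "v = of_int m + of_int n * sqrt 2" "v' = of_int m - of_int n * sqrt 2"
    using v by (auto simp: galois_pair_def)
  have s: "7/5 \<le> sqrt 2" by (rule real_le_rsqrt) (simp add: power2_eq_square)
  have "v < 15/4" using v assms by simp
  have m: "m = 2 \<or> m = 3"
  proof -
    have "3 \<le> 2 * real_of_int m" "2 * real_of_int m < 7" using mn v \<open>v < 15/4\<close> by linarith+
    then show ?thesis by linarith
  qed
  have n: "n = 0 \<or> n = 1"
  proof -
    have "0 \<le> of_int n * sqrt 2" "of_int n * sqrt 2 \<le> 15/8" using mn v \<open>v < 15/4\<close> by linarith+
    then have "0 \<le> n" by (simp add: zero_le_mult_iff)
    then have "real_of_int n * (7/5) \<le> of_int n * sqrt 2" using s by (intro mult_left_mono) auto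
    then have "real_of_int n * (7/5) \<le> 15/8" using \<open>of_int n * sqrt 2 \<le> 15/8\<close> by linarith
    then have "n < 2" by linarith
    with \<open>0 \<le> n\<close> show ?thesis by auto
  qed
  have "v \<noteq> 2 + sqrt 2"
    unfolding v(1)[symmetric] y height_order_elt
    by (intro eisenstein_neq_prime_over_2 O_K_closed c)
  with m n mn v s \<open>v < 15/4\<close> have "v = 3" by auto
  then have h: "height y = 1" using v by simp
  then have "(4 + 3 * sqrt 2) * eisenstein c2 c3 = 0"
    using nrd_order_elt[of c0 c1 c2 c3] assms y by (simp add: norm_one_units_def)
  moreover have "4 + 3 * sqrt 2 \<noteq> (0::real)" using s by linarith
  ultimately have "eisenstein c2 c3 = 0" by simp
  moreover have "4 * eisenstein c2 c3 = (2 * c2 + c3)\<^sup>2 + 3 * c3\<^sup>2" "4 * eisenstein c2 c3 = (2 * c3 + c2)\<^sup>2 + 3 * c2\<^sup>2"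
    by (simp_all add: power2_eq_square algebra_simps)
  ultimately have z: "c2 = 0" "c3 = 0"
    by (smt (verit) zero_le_power2 zero_less_power2)+
  have "eisenstein c0 c1 = 1"
    using h height_order_elt[of c0 c1 0 0] by (simp add: y z power2_eq_square algebra_simps)
  from eisenstein_unit[OF c(1,2) this] show ?thesis by (auto simp: y z)
qed

lemma alpha_order_elt: "alpha = order_elt 0 1 0 0"
  and beta_order_elt: "beta = order_elt 0 1 0 (sqrt 2 - 1)"
  by (simp_all add: alpha_def beta_def order_elt_def field_simps)

lemma conj_order_elt:
  "quat_conj (order_elt c0 c1 c2 c3) = order_elt (c0 + c1 + c2) (- c1) (- c2) (- c3)"
  by (simp add: order_elt_def field_simps)

lemma order_elt_in_Q_B:
  "c0 \<in> O_K \<Longrightarrow> c1 \<in> O_K \<Longrightarrow> c2 \<in> O_K \<Longrightarrow> c3 \<in> O_K \<Longrightarrow> order_elt c0 c1 c2 c3 \<in> Q_B"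
  by (auto simp: Q_B_eq)

lemma Q_B_closed:
  assumes "x \<in> Q_B"
  shows "y \<in> Q_B \<Longrightarrow> x \<star> y \<in> Q_B" "quat_conj x \<in> Q_B"
proof -
  obtain c0 c1 c2 c3 where x: "x = order_elt c0 c1 c2 c3"
    and c: "c0 \<in> O_K" "c1 \<in> O_K" "c2 \<in> O_K" "c3 \<in> O_K"
    using assms by (auto simp: Q_B_eq)
  show "quat_conj x \<in> Q_B"
    unfolding x conj_order_elt by (intro order_elt_in_Q_B O_K_closed c)
  assume "y \<in> Q_B"
  then obtain d0 d1 d2 d3 where y: "y = order_elt d0 d1 d2 d3"
    and d: "d0 \<in> O_K" "d1 \<in> O_K" "d2 \<in> O_K" "d3 \<in> O_K"
    by (auto simp: Q_B_eq)
  show "x \<star> y \<in> Q_B"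
    unfolding x y order_elt_mult by (intro order_elt_in_Q_B O_K_closed c d)
qed

lemma nrd_conj: "nrd (quat_conj x) = nrd x"
  by (cases x) (simp add: nrd_def)

lemma norm_one_units_closed:
  "x \<in> norm_one_units \<Longrightarrow> y \<in> norm_one_units \<Longrightarrow> x \<star> y \<in> norm_one_units" "x \<in> norm_one_units \<Longrightarrow> quat_conj x \<in> norm_one_units"
  by (auto simp: norm_one_units_def Q_B_closed nrd_mult nrd_conj)

lemma alpha_beta_norm_one_units: "alpha \<in> norm_one_units" "beta \<in> norm_one_units"
proof -
  have "order_elt 0 1 0 0 \<in> Q_B" "order_elt 0 1 0 (sqrt 2 - 1) \<in> Q_B"
    by (intro order_elt_in_Q_B O_K_closed)+
  then show "alpha \<in> norm_one_units" "beta \<in> norm_one_units"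
    by (simp_all add: norm_one_units_def nrd_alpha nrd_beta flip: alpha_order_elt beta_order_elt)
qed

lemma conj_mult_cancel: "nrd x = 1 \<Longrightarrow> quat_conj x \<star> (x \<star> y) = y"
  by (cases y) (simp add: quat_mult_assoc[symmetric] quat_mult_conj nrd_def del: quat_mult.simps; simp)

text \<open>Descent on \<open>\<lfloor>9 N(z\<^sub>1)\<rfloor>\<close>: an element of large height becomes lower under left multiplication by some
  \<open>\<beta>\<^sup>\<plusminus>\<^sup>1 \<alpha>\<^sup>k\<close>, and those of small height are the powers of \<open>\<alpha>\<close>.\<close>
theorem norm_one_units_subset_generated:
  assumes gens: "alpha \<in> H" "beta \<in> H"
    and mult: "\<And>x y. x \<in> H \<Longrightarrow> y \<in> H \<Longrightarrow> x \<star> y \<in> H"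
    and conj: "\<And>x. x \<in> H \<Longrightarrow> quat_conj x \<in> H"
  shows "norm_one_units \<subseteq> H"
proof
  fix y assume "y \<in> norm_one_units"
  then show "y \<in> H"
  proof (induction "nat \<lfloor>9 * height y\<rfloor>" arbitrary: y rule: less_induct)
    case less
    show ?case
    proof (cases "height y < 5/4")
      case True
      have a2: "alpha \<star> alpha = order_elt (-1) 1 0 0" "alpha \<star> (alpha \<star> alpha) = order_elt (-1) 0 0 0"
        "quat_conj alpha = order_elt 1 (-1) 0 0" "alpha \<star> quat_conj alpha = order_elt 1 0 0 0"
        "quat_conj (alpha \<star> alpha) = order_elt 0 (-1) 0 0"
        by (simp_all add: alpha_def order_elt_def)
      have "order_elt (-1) 1 0 0 \<in> H" "order_elt (-1) 0 0 0 \<in> H" "order_elt 1 (-1) 0 0 \<in> H"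
        "order_elt 1 0 0 0 \<in> H" "order_elt 0 (-1) 0 0 \<in> H"
        unfolding a2[symmetric] by (intro mult conj gens)+
      with low_height_imp_root_of_unity[OF less(2) True] gens show ?thesis
        by (auto simp: alpha_order_elt)
    next
      case False
      have "nrd y = 1" using less(2) by (simp add: norm_one_units_def)
      with low_height[of y] False obtain b a
        where b: "b \<in> {beta, quat_conj beta}" and a: "a \<in> {y, alpha \<star> y, alpha \<star> (alpha \<star> y)}"
          and drop: "height (b \<star> a) < height y"
        by (meson not_le)
      obtain g where g: "g \<in> H" "g \<in> norm_one_units" "b \<star> a = g \<star> y"
      proof (rule that)
        define g where "g = (if a = y then b else if a = alpha \<star> y then b \<star> alpha else b \<star> (alpha \<star> alpha))"
        show "g \<in> H" using b gens by (auto simp: g_def intro: mult conj)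
        show "g \<in> norm_one_units" using b alpha_beta_norm_one_units by (auto simp: g_def intro: norm_one_units_closed)
        show "b \<star> a = g \<star> y" using a by (auto simp: g_def quat_mult_assoc simp del: quat_mult.simps)
      qed
      have Q: "g \<star> y \<in> norm_one_units" using g less(2) norm_one_units_closed by blast
      have "9 * height (g \<star> y) + 1 \<le> 9 * height y"
        using height_gap[OF less(2) Q] drop g by simp
      moreover have "0 \<le> height (g \<star> y)" by (cases "g \<star> y") simp
      ultimately have "nat \<lfloor>9 * height (g \<star> y)\<rfloor> < nat \<lfloor>9 * height y\<rfloor>" by linarith
      then have "g \<star> y \<in> H" using less(1) Q by blast
      then have "quat_conj g \<star> (g \<star> y) \<in> H" using g mult conj by blast
      then show ?thesis using g by (simp add: conj_mult_cancel norm_one_units_def)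
    qed
  qed
qed

section \<open>Words and the triangle group\<close>

definition word_inv :: "'g word \<Rightarrow> 'g word" where
  "word_inv w = rev (map (\<lambda>(g, s). (g, \<not> s)) w)"

lemma word_inv_simps [simp]:
  "word_inv [] = []" "word_inv (l # w) = word_inv w @ [(fst l, \<not> snd l)]"
  by (simp_all add: word_inv_def split_beta)

lemma word_inv_append [simp]: "word_inv (u @ v) = word_inv v @ word_inv u"
  by (simp add: word_inv_def)

lemma word_inv_inv [simp]: "word_inv (word_inv w) = w"
  by (induction w) auto

lemma pres_eq_right_inverse: "pres_eq R (w @ word_inv w) []"
proof (induction w)
  case (Cons l w)
  have "pres_eq R ([l] @ (w @ word_inv w) @ [(fst l, \<not> snd l)]) ([l] @ [] @ [(fst l, \<not> snd l)])"
    by (rule pres_eq_context[OF Cons])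
  moreover have "pres_eq R ([] @ [(fst l, snd l), (fst l, \<not> snd l)] @ []) ([] @ [])"
    by (rule pres_eq.cancel)
  ultimately show ?case by (auto intro: pres_eq.trans)
qed (simp add: pres_eq.refl)

lemma pres_eq_left_inverse: "pres_eq R (word_inv w @ w) []"
  using pres_eq_right_inverse[of R "word_inv w"] by simp

lemma pres_eq_inverseI:
  assumes "pres_eq R (u @ v) []"
  shows "pres_eq R u (word_inv v)"
proof -
  have "pres_eq R (u @ (v @ word_inv v)) (u @ [])"
    by (intro pres_eq_append pres_eq.refl pres_eq_right_inverse)
  moreover have "pres_eq R ((u @ v) @ word_inv v) ([] @ word_inv v)"
    by (intro pres_eq_append pres_eq.refl assms)
  ultimately show ?thesis by (auto intro: pres_eq.trans pres_eq.sym)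
qed

lemma pres_eq_rotate:
  assumes "pres_eq R (u @ v) []"
  shows "pres_eq R (v @ u) []"
proof -
  have "pres_eq R (v @ u) (v @ word_inv v)"
    by (intro pres_eq_append pres_eq.refl pres_eq_inverseI assms)
  then show ?thesis using pres_eq_right_inverse pres_eq.trans by blast
qed

definition triangle_relators :: "triangle_gen word set" where
  "triangle_relators = {replicate 3 (Gen_a, True), replicate 3 (Gen_b, True),
     concat (replicate 4 [(Gen_a, True), (Gen_b, True)])}"

lemma triangle_group_eq: "triangle_group 3 3 4 = presented_group triangle_relators"
  by (simp add: triangle_group_def triangle_relators_def)

abbreviation triangle_eq :: "triangle_gen word \<Rightarrow> triangle_gen word \<Rightarrow> bool" where
  "triangle_eq \<equiv> pres_eq triangle_relators"

lemma triangle_relations: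
  "triangle_eq [(Gen_a, True), (Gen_a, True), (Gen_a, True)] []"
  "triangle_eq [(Gen_b, True), (Gen_b, True), (Gen_b, True)] []"
  "triangle_eq [(Gen_a, True), (Gen_b, True), (Gen_a, True), (Gen_b, True),
     (Gen_a, True), (Gen_b, True), (Gen_a, True), (Gen_b, True)] []"
proof -
  have relator: "triangle_eq r []" if "r \<in> triangle_relators" for r
    using pres_eq.relator[OF that, of "[]" "[]"] by simp
  show "triangle_eq [(Gen_a, True), (Gen_a, True), (Gen_a, True)] []"
    "triangle_eq [(Gen_b, True), (Gen_b, True), (Gen_b, True)] []"
    "triangle_eq [(Gen_a, True), (Gen_b, True), (Gen_a, True), (Gen_b, True),
       (Gen_a, True), (Gen_b, True), (Gen_a, True), (Gen_b, True)] []"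
    by (rule relator; simp add: triangle_relators_def numeral_eq_Suc)+
qed

section \<open>The Coxeter group of the triangle\<close>

text \<open>The reflections in the sides \<open>P R\<close>, \<open>P Q\<close>, \<open>Q R\<close> of the triangle, in this order.\<close>
datatype mirror = Mir_r | Mir_s | Mir_t

text \<open>The geometric representation: in the basis of simple roots, with the bilinear form given by
  \<open>B(r, s) = B(s, t) = - cos (\<pi>/3)\<close>, \<open>B(r, t) = - cos (\<pi>/4)\<close> and \<open>B(m, m) = 1\<close>, the reflection of
  \<open>v\<close> in the root of \<open>m\<close> is \<open>v - 2 B(v, m) m\<close>.\<close>
fun reflect :: "mirror \<Rightarrow> real \<times> real \<times> real \<Rightarrow> real \<times> real \<times> real" where
  "reflect Mir_r (x, y, z) = (- x + y + sqrt 2 * z, y, z)"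
| "reflect Mir_s (x, y, z) = (x, x - y + z, z)"
| "reflect Mir_t (x, y, z) = (x, y, sqrt 2 * x + y - z)"

fun simple_root :: "mirror \<Rightarrow> real \<times> real \<times> real" where
  "simple_root Mir_r = (1, 0, 0)"
| "simple_root Mir_s = (0, 1, 0)"
| "simple_root Mir_t = (0, 0, 1)"

definition act :: "mirror list \<Rightarrow> real \<times> real \<times> real \<Rightarrow> real \<times> real \<times> real" where
  "act w v = foldr reflect w v"

lemma act_simps [simp]:
  "act [] v = v" "act (m # w) v = reflect m (act w v)" "act (u @ w) = act u \<circ> act w"
  by (simp_all add: act_def fun_eq_iff)

lemma reflect_linear: "reflect m (a *\<^sub>R u + b *\<^sub>R v) = a *\<^sub>R reflect m u + b *\<^sub>R reflect m v"
  by (cases m; cases u; cases v) (simp_all add: algebra_simps)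

lemma act_linear: "act w (a *\<^sub>R u + b *\<^sub>R v) = a *\<^sub>R act w u + b *\<^sub>R act w v"
  by (induction w) (simp_all add: reflect_linear)

lemma act_braid:
  "act [m, m] = act []"
  "act [Mir_r, Mir_s, Mir_r] = act [Mir_s, Mir_r, Mir_s]"
  "act [Mir_s, Mir_t, Mir_s] = act [Mir_t, Mir_s, Mir_t]"
  "act [Mir_r, Mir_t, Mir_r, Mir_t] = act [Mir_t, Mir_r, Mir_t, Mir_r]"
  by (cases m; auto simp: fun_eq_iff algebra_simps; fail)
     (auto simp: fun_eq_iff algebra_simps)

text \<open>The Coxeter group is the semidirect product of the triangle group with the group of order two
  generated by \<open>s\<close>, which inverts \<open>a\<close> and \<open>b\<close>. Put \<open>c(r) = a\<close>, \<open>c(s) = 1\<close>, \<open>c(t) = b\<^sup>-\<^sup>1\<close>. Then an even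
  word \<open>x\<^sub>1 x\<^sub>2 \<dots> x\<^sub>2\<^sub>n\<close> in the mirrors corresponds to the alternating product
  \<open>c(x\<^sub>1) c(x\<^sub>2)\<^sup>-\<^sup>1 \<dots> c(x\<^sub>2\<^sub>n)\<^sup>-\<^sup>1\<close>; for instance \<open>r s\<close>, \<open>s t\<close> and \<open>r t\<close> go to \<open>a\<close>, \<open>b\<close> and \<open>a b\<close>.
  The Boolean argument of \<open>alternate\<close> selects the sign of the first exponent.\<close>
fun mirror_word :: "mirror \<Rightarrow> triangle_gen word" where
  "mirror_word Mir_r = [(Gen_a, True)]"
| "mirror_word Mir_s = []"
| "mirror_word Mir_t = [(Gen_b, False)]"

fun alternate :: "bool \<Rightarrow> mirror list \<Rightarrow> triangle_gen word" where
  "alternate b [] = []"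
| "alternate b (m # w) =
    (if b then mirror_word m else word_inv (mirror_word m)) @ alternate (\<not> b) w"

lemma alternate_append:
  "alternate b (u @ v) =
    alternate b u @ alternate (if even (length u) then b else \<not> b) v"
  by (induction u arbitrary: b) auto

text \<open>Instead of the congruence generated by the Coxeter relations, an a priori coarser one is used that
  retains everything needed at the end: two words agree if they have the same action, the same
  parity and the same alternating products. The parity makes it compatible with concatenation, as it
  decides the sign with which the second factor starts.\<close>
definition mirror_eq :: "mirror list \<Rightarrow> mirror list \<Rightarrow> bool" where
  "mirror_eq u v \<longleftrightarrow> act u = act v \<and> even (length u) = even (length v) \<and>
     (\<forall>b. triangle_eq (alternate b u) (alternate b v))"

lemma mirror_eq_refl [simp]: "mirror_eq u u"
  by (simp add: mirror_eq_def pres_eq.refl)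

lemma mirror_eq_sym: "mirror_eq u v \<Longrightarrow> mirror_eq v u"
  by (auto simp: mirror_eq_def intro: pres_eq.sym)

lemma mirror_eq_trans [trans]: "mirror_eq u v \<Longrightarrow> mirror_eq v w \<Longrightarrow> mirror_eq u w"
  by (fastforce simp: mirror_eq_def intro: pres_eq.trans)

lemma mirror_eq_append:
  assumes "mirror_eq u u'" "mirror_eq v v'"
  shows "mirror_eq (u @ v) (u' @ v')"
  using assms by (auto simp: mirror_eq_def alternate_append intro: pres_eq_append)

lemma mirror_eq_square: "mirror_eq [m, m] []"
  using pres_eq_right_inverse[of _ "mirror_word m"] pres_eq_left_inverse[of _ "mirror_word m"]
  by (auto simp: mirror_eq_def act_braid simp del: act_simps)

lemma mirror_eq_braid:
  "mirror_eq [Mir_r, Mir_s, Mir_r] [Mir_s, Mir_r, Mir_s]"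
  "mirror_eq [Mir_s, Mir_t, Mir_s] [Mir_t, Mir_s, Mir_t]"
  "mirror_eq [Mir_r, Mir_t, Mir_r, Mir_t] [Mir_t, Mir_r, Mir_t, Mir_r]"
proof -
  let ?a = "(Gen_a, True)" and ?b = "(Gen_b, True)"
  let ?a' = "(Gen_a, False)" and ?b' = "(Gen_b, False)"
  have "triangle_eq [?a, ?a] [?a']" "triangle_eq [?a] [?a', ?a']"
    using pres_eq_inverseI[of _ "[?a, ?a]" "[?a]"] pres_eq_inverseI[of _ "[?a]" "[?a, ?a]"]
      triangle_relations(1) by simp_all
  then show "mirror_eq [Mir_r, Mir_s, Mir_r] [Mir_s, Mir_r, Mir_s]"
    by (auto simp: mirror_eq_def act_braid all_bool_eq pres_eq.sym simp del: act_simps)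
  have "triangle_eq [?b, ?b] [?b']" "triangle_eq [?b] [?b', ?b']"
    using pres_eq_inverseI[of _ "[?b, ?b]" "[?b]"] pres_eq_inverseI[of _ "[?b]" "[?b, ?b]"]
      triangle_relations(2) by simp_all
  then show "mirror_eq [Mir_s, Mir_t, Mir_s] [Mir_t, Mir_s, Mir_t]"
    by (auto simp: mirror_eq_def act_braid all_bool_eq pres_eq.sym simp del: act_simps)
  have "triangle_eq [?a, ?b, ?a, ?b] [?b', ?a', ?b', ?a']"
    using pres_eq_inverseI[of _ "[?a, ?b, ?a, ?b]" "[?a, ?b, ?a, ?b]"] triangle_relations(3) by simp
  moreover have "triangle_eq [?b, ?a, ?b, ?a, ?b, ?a, ?b, ?a] []"
    using pres_eq_rotate[of _ "[?a]" "[?b, ?a, ?b, ?a, ?b, ?a, ?b]"] triangle_relations(3) by simp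
  then have "triangle_eq [?b, ?a, ?b, ?a] [?a', ?b', ?a', ?b']"
    using pres_eq_inverseI[of _ "[?b, ?a, ?b, ?a]" "[?b, ?a, ?b, ?a]"] by simp
  ultimately show "mirror_eq [Mir_r, Mir_t, Mir_r, Mir_t] [Mir_t, Mir_r, Mir_t, Mir_r]"
    by (auto simp: mirror_eq_def act_braid all_bool_eq pres_eq.sym simp del: act_simps)
qed

lemma mirror_eq_cancel: "mirror_eq (u @ [m, m] @ v) (u @ v)"
  using mirror_eq_append[OF mirror_eq_refl[of u]
      mirror_eq_append[OF mirror_eq_square mirror_eq_refl[of v]]] by simp

text \<open>Reduction letter by letter. For the subgroup generated by two mirrors, \<open>L\<close> is the set of
  alternating words up to the length of the longest element.\<close>
lemma word_normal_form:
  assumes "[] \<in> L"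
    and "\<And>y c. y \<in> L \<Longrightarrow> c \<in> A \<Longrightarrow> \<exists>y'\<in>L. mirror_eq (y @ [c]) y' \<and> length y' \<le> Suc (length y)"
    and "set x \<subseteq> A"
  shows "\<exists>y\<in>L. mirror_eq x y \<and> length y \<le> length x"
  using assms(3)
proof (induction x rule: rev_induct)
  case Nil
  then show ?case using assms(1) by (auto intro!: bexI[of _ "[]"])
next
  case (snoc c x)
  then obtain y where y: "y \<in> L" "mirror_eq x y" "length y \<le> length x" by auto
  with assms(2)[of y c] snoc obtain y' where y':
    "y' \<in> L" "mirror_eq (y @ [c]) y'" "length y' \<le> Suc (length y)" by auto
  have "mirror_eq (x @ [c]) (y @ [c])" using y by (simp add: mirror_eq_append)
  with y' y show ?case by (intro bexI[of _ y']) (auto intro: mirror_eq_trans)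
qed

section \<open>Positive roots\<close>

text \<open>The combinatorial counterpart of \<open>x\<close> sending the root of \<open>s\<close> to a negative root.\<close>
definition descends :: "mirror list \<Rightarrow> mirror \<Rightarrow> mirror set \<Rightarrow> bool" where
  "descends x s A \<longleftrightarrow> (\<exists>x'. set x' \<subseteq> A \<and> mirror_eq x (x' @ [s]) \<and> length x' < length x)"

lemma descendsI: "mirror_eq x (x' @ [s]) \<Longrightarrow> set x' \<subseteq> A \<Longrightarrow> length x' < length x \<Longrightarrow> descends x s A"
  by (auto simp: descends_def)

text \<open>In a dihedral group of order \<open>6\<close> every word is equivalent to an alternating one of length at most
  \<open>3\<close>. Those that cannot be made to end in \<open>s\<close> are the empty word, \<open>t\<close> and \<open>s t\<close>; they send the root of \<open>s\<close> to a
  nonnegative combination. The same scheme serves for order \<open>8\<close> below.\<close>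
lemma dihedral_positive_3:
  assumes braid: "mirror_eq [s, t, s] [t, s, t]"
    and "act [t] (simple_root s) = simple_root s + simple_root t" "act [s, t] (simple_root s) = simple_root t"
    and x: "set x \<subseteq> {s, t}"
  shows "descends x s {s, t} \<or> (\<exists>p q. 0 \<le> p \<and> 0 \<le> q \<and> act x (simple_root s) = p *\<^sub>R simple_root s + q *\<^sub>R simple_root t)"
proof -
  let ?L = "{[], [s], [t], [s, t], [t, s], [t, s, t]}"
  have step: "\<exists>y'\<in>?L. mirror_eq (y @ [c]) y' \<and> length y' \<le> Suc (length y)"
    if "y \<in> ?L" "c \<in> {s, t}" for y c
  proof -
    have 1: "mirror_eq [t, s, t, s] [s, t]"
      using mirror_eq_append[OF mirror_eq_sym[OF braid] mirror_eq_refl[of "[s]"]]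
        mirror_eq_cancel[of "[s, t]" s "[]"] by (auto intro: mirror_eq_trans)
    show ?thesis
      using that 1 braid mirror_eq_cancel[of "[]" s "[]"] mirror_eq_cancel[of "[]" t "[]"]
        mirror_eq_cancel[of "[t]" s "[]"] mirror_eq_cancel[of "[s]" t "[]"]
        mirror_eq_cancel[of "[t, s]" t "[]"]
      by auto
  qed
  obtain y where y: "y \<in> ?L" "mirror_eq x y" "length y \<le> length x"
    using word_normal_form[OF _ step x] by blast
  have act: "act x = act y" using y(2) by (simp add: mirror_eq_def)
  consider "y = []" | "y = [t]" | "y = [s, t]" | "y = [s]" | "y = [t, s]" | "y = [t, s, t]"
    using y(1) by auto
  then show ?thesis
  proof cases
    case 1
    then show ?thesis by (intro disjI2 exI[of _ 1] exI[of _ 0]) (simp add: act)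
  next
    case 2
    then show ?thesis using assms by (intro disjI2 exI[of _ 1] exI[of _ 1]) (simp add: act)
  next
    case 3
    then show ?thesis using assms by (intro disjI2 exI[of _ 0] exI[of _ 1]) (simp add: act)
  next
    case 4
    then show ?thesis using y by (intro disjI1 descendsI[of _ "[]"]) auto
  next
    case 5
    then show ?thesis using y by (intro disjI1 descendsI[of _ "[t]"]) auto
  next
    case 6
    then have "mirror_eq x [s, t, s]" using y braid mirror_eq_trans mirror_eq_sym by blast
    then show ?thesis using y 6 by (intro disjI1 descendsI[of _ "[s, t]"]) auto
  qed
qed

lemma dihedral_positive_4:
  assumes braid: "mirror_eq [s, t, s, t] [t, s, t, s]"
    and "act [t] (simple_root s) = simple_root s + sqrt 2 *\<^sub>R simple_root t"
    and "act [s, t] (simple_root s) = simple_root s + sqrt 2 *\<^sub>R simple_root t" "act [t, s, t] (simple_root s) = simple_root s"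
    and x: "set x \<subseteq> {s, t}"
  shows "descends x s {s, t} \<or> (\<exists>p q. 0 \<le> p \<and> 0 \<le> q \<and> act x (simple_root s) = p *\<^sub>R simple_root s + q *\<^sub>R simple_root t)"
proof -
  let ?L = "{[], [s], [t], [s, t], [t, s], [t, s, t], [s, t, s], [s, t, s, t]}"
  have step: "\<exists>y'\<in>?L. mirror_eq (y @ [c]) y' \<and> length y' \<le> Suc (length y)"
    if "y \<in> ?L" "c \<in> {s, t}" for y c
  proof -
    have 1: "mirror_eq [s, t, s, t, s] [t, s, t]"
      using mirror_eq_append[OF braid mirror_eq_refl[of "[s]"]]
        mirror_eq_cancel[of "[t, s, t]" s "[]"] by (auto intro: mirror_eq_trans)
    show ?thesis
      using that 1 mirror_eq_sym[OF braid]
        mirror_eq_cancel[of "[]" s "[]"] mirror_eq_cancel[of "[]" t "[]"]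
        mirror_eq_cancel[of "[t]" s "[]"] mirror_eq_cancel[of "[s]" t "[]"]
        mirror_eq_cancel[of "[t, s]" t "[]"] mirror_eq_cancel[of "[s, t]" s "[]"]
        mirror_eq_cancel[of "[s, t, s]" t "[]"]
      by auto
  qed
  obtain y where y: "y \<in> ?L" "mirror_eq x y" "length y \<le> length x"
    using word_normal_form[OF _ step x] by blast
  have act: "act x = act y" using y(2) by (simp add: mirror_eq_def)
  consider "y = []" | "y = [t]" | "y = [s, t]" | "y = [t, s, t]" | "y = [s]" | "y = [t, s]"
    | "y = [s, t, s]" | "y = [s, t, s, t]"
    using y(1) by auto
  then show ?thesis
  proof cases
    case 1
    then show ?thesis by (intro disjI2 exI[of _ 1] exI[of _ 0]) (simp add: act)
  next
    case 2
    then show ?thesis using assms by (intro disjI2 exI[of _ 1] exI[of _ "sqrt 2"]) (simp add: act)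
  next
    case 3
    then show ?thesis using assms by (intro disjI2 exI[of _ 1] exI[of _ "sqrt 2"]) (simp add: act)
  next
    case 4
    then show ?thesis using assms by (intro disjI2 exI[of _ 1] exI[of _ 0]) (simp add: act)
  next
    case 5
    then show ?thesis using y by (intro disjI1 descendsI[of _ "[]"]) auto
  next
    case 6
    then show ?thesis using y by (intro disjI1 descendsI[of _ "[t]"]) auto
  next
    case 7
    then show ?thesis using y by (intro disjI1 descendsI[of _ "[s, t]"]) auto
  next
    case 8
    then have "mirror_eq x [t, s, t, s]" using y braid mirror_eq_trans by blast
    then show ?thesis using y 8 by (intro disjI1 descendsI[of _ "[t, s, t]"]) auto
  qed
qed

lemma dihedral_positive:
  assumes "s \<noteq> t" "set x \<subseteq> {s, t}"
  shows "descends x s {s, t} \<or> (\<exists>p q. 0 \<le> p \<and> 0 \<le> q \<and> act x (simple_root s) = p *\<^sub>R simple_root s + q *\<^sub>R simple_root t)"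
proof -
  consider "s = Mir_r" "t = Mir_t" | "s = Mir_t" "t = Mir_r"
    | "s = Mir_r" "t = Mir_s" | "s = Mir_s" "t = Mir_r" | "s = Mir_s" "t = Mir_t" | "s = Mir_t" "t = Mir_s"
    using assms(1) by (cases s; cases t) auto
  then show ?thesis
    using assms(2) mirror_eq_braid mirror_eq_braid[THEN mirror_eq_sym]
    by cases ((rule dihedral_positive_3 dihedral_positive_4; simp; fail)+)
qed

definition nonneg3 :: "real \<times> real \<times> real \<Rightarrow> bool" where
  "nonneg3 v \<longleftrightarrow> 0 \<le> fst v \<and> 0 \<le> fst (snd v) \<and> 0 \<le> snd (snd v)"

lemma nonneg3_combination:
  "nonneg3 u \<Longrightarrow> nonneg3 v \<Longrightarrow> 0 \<le> p \<Longrightarrow> 0 \<le> q \<Longrightarrow> nonneg3 (p *\<^sub>R u + q *\<^sub>R v)"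
  by (auto simp: nonneg3_def)

text \<open>The argument of Tits, by induction on the length of \<open>w\<close>. If \<open>w\<close> ends in \<open>t \<noteq> s\<close>, write \<open>w = v x\<close> with \<open>x\<close> a
  word in \<open>s\<close> and \<open>t\<close> and \<open>v\<close> as short as possible. By minimality and induction \<open>v\<close> keeps the roots of \<open>s\<close>
  and \<open>t\<close> positive, so the claim reduces to the dihedral word \<open>x\<close>.\<close>
lemma root_positive_or_descends: "nonneg3 (act w (simple_root s)) \<or> descends w s UNIV"
proof (induction "length w" arbitrary: w s rule: less_induct)
  case less
  show ?case
  proof (cases w rule: rev_cases)
    case Nil
    then show ?thesis by (cases s) (auto simp: nonneg3_def)
  next
    case (snoc u t)
    show ?thesis
    proof (cases "t = s")
      case True
      with snoc show ?thesis by (intro disjI2 descendsI[of _ u]) auto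
    next
      case False
      define P where "P v \<longleftrightarrow> (\<exists>x. set x \<subseteq> {s, t} \<and> mirror_eq w (v @ x) \<and>
        length v + length x \<le> length w)" for v
      have "P u" using snoc by (auto simp: P_def intro: exI[of _ "[t]"])
      then obtain v where "P v" and min: "\<And>v'. P v' \<Longrightarrow> length v \<le> length v'"
        using ex_has_least_nat[of P u length] by auto
      then obtain x where x: "set x \<subseteq> {s, t}" "mirror_eq w (v @ x)"
        "length v + length x \<le> length w" by (auto simp: P_def)
      have short: "length v < length w" using min[OF \<open>P u\<close>] snoc by simp
      \<comment> \<open>Otherwise a letter \<open>m\<close> could be moved from the end of \<open>v\<close> to the front of \<open>x\<close>.\<close>
      have pos: "nonneg3 (act v (simple_root m))" if "m \<in> {s, t}" for m
      proof (rule ccontr)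
        assume "\<not> nonneg3 (act v (simple_root m))"
        with less[OF short] obtain v' where v': "mirror_eq v (v' @ [m])" "length v' < length v"
          by (auto simp: descends_def)
        have "mirror_eq w (v' @ m # x)"
          using mirror_eq_trans[OF x(2) mirror_eq_append[OF v'(1) mirror_eq_refl[of x]]] by simp
        with x v' that have "P v'" by (auto simp: P_def intro!: exI[of _ "m # x"])
        then show False using min v'(2) by force
      qed
      have act: "act w = act (v @ x)" using x(2) by (simp add: mirror_eq_def)
      from dihedral_positive[of s t x] False x(1) consider "descends x s {s, t}" |
        p q where "0 \<le> p" "0 \<le> q" "act x (simple_root s) = p *\<^sub>R simple_root s + q *\<^sub>R simple_root t" by auto
      then show ?thesis
      proof cases
        case 1
        then obtain x' where x': "mirror_eq x (x' @ [s])" "length x' < length x"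
          by (auto simp: descends_def)
        have "mirror_eq w ((v @ x') @ [s])"
          using mirror_eq_trans[OF x(2) mirror_eq_append[OF mirror_eq_refl[of v] x'(1)]] by simp
        then show ?thesis using x' x(3) by (intro disjI2 descendsI[of _ "v @ x'"]) auto
      next
        case 2
        then have "act w (simple_root s) = p *\<^sub>R act v (simple_root s) + q *\<^sub>R act v (simple_root t)"
          by (simp add: act act_linear)
        then show ?thesis using 2 pos by (simp add: nonneg3_combination)
      qed
    qed
  qed
qed

text \<open>The last letter \<open>s\<close> of a shortest equivalent word \<open>v s\<close> leads to a contradiction: if \<open>v s\<close> acts
  trivially, then \<open>v\<close> sends the root of \<open>s\<close> to its negative, so \<open>v\<close> can be made to end in \<open>s\<close> as well and two
  letters cancel.\<close>
theorem trivial_action_imp_mirror_eq_Nil: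
  assumes "act w = id"
  shows "mirror_eq w []"
proof -
  obtain u where u: "mirror_eq w u" and min: "\<And>u'. mirror_eq w u' \<Longrightarrow> length u \<le> length u'"
    using ex_has_least_nat[of "mirror_eq w" w length] by auto
  show ?thesis
  proof (cases u rule: rev_cases)
    case Nil
    with u show ?thesis by simp
  next
    case (snoc v s)
    have "act (v @ [s]) = id" using u assms snoc by (simp add: mirror_eq_def)
    then have "act v (reflect s (simple_root s)) = simple_root s" by (metis act_simps comp_apply id_apply)
    moreover have "reflect s (simple_root s) = (-1) *\<^sub>R simple_root s + 0 *\<^sub>R simple_root s" by (cases s) auto
    ultimately have "act v (simple_root s) = - simple_root s"
      by (simp only: act_linear) (simp add: minus_equation_iff)
    then have "\<not> nonneg3 (act v (simple_root s))" by (cases s) (auto simp: nonneg3_def)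
    with root_positive_or_descends obtain v' where v': "mirror_eq v (v' @ [s])" "length v' < length v"
      by (auto simp: descends_def)
    have "mirror_eq w (v' @ [s, s] @ [])"
      using mirror_eq_trans[OF u[unfolded snoc] mirror_eq_append[OF v'(1) mirror_eq_refl[of "[s]"]]] by simp
    then have "mirror_eq w v'" using mirror_eq_cancel[of v' s "[]"] mirror_eq_trans by fastforce
    with min v' snoc show ?thesis by force
  qed
qed

section \<open>Evaluation of words in the unit group\<close>

fun letter :: "triangle_gen \<times> bool \<Rightarrow> real quat" where
  "letter (Gen_a, s) = (if s then alpha else quat_conj alpha)"
| "letter (Gen_b, s) = (if s then beta else quat_conj beta)"

definition eval_word :: "triangle_gen word \<Rightarrow> real quat" where
  "eval_word w = foldr (\<lambda>l x. letter l \<star> x) w (1, 0, 0, 0)"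

lemma qmul_one: "(1, 0, 0, 0) \<star> x = x" "x \<star> (1, 0, 0, 0) = x"
  by (cases x; simp)+

lemma eval_word_Nil: "eval_word [] = (1, 0, 0, 0)"
  by (simp add: eval_word_def)

lemma eval_word_Cons: "eval_word (l # w) = letter l \<star> eval_word w"
  by (simp add: eval_word_def)

lemma eval_word_append: "eval_word (u @ v) = eval_word u \<star> eval_word v"
  by (induction u)
    (simp_all add: eval_word_Nil eval_word_Cons qmul_one quat_mult_assoc del: quat_mult.simps)

lemma letter_in_norm_one_units: "letter l \<in> norm_one_units"
  by (cases l rule: letter.cases) (auto intro: alpha_beta_norm_one_units norm_one_units_closed)

lemma one_in_norm_one_units: "(1, 0, 0, 0) \<in> norm_one_units"
proof -
  have "order_elt 1 0 0 0 \<in> Q_B" by (intro order_elt_in_Q_B O_K_closed)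
  then show ?thesis by (simp add: norm_one_units_def order_elt_def nrd_def)
qed

lemma eval_word_in_norm_one_units: "eval_word w \<in> norm_one_units"
  by (induction w) (simp_all add: eval_word_Nil eval_word_Cons one_in_norm_one_units norm_one_units_closed letter_in_norm_one_units)

lemma nrd_norm_one_units: "x \<in> norm_one_units \<Longrightarrow> nrd x = 1"
  by (simp add: norm_one_units_def)

lemma quat_conj_mult: "quat_conj (x \<star> y) = quat_conj y \<star> quat_conj x"
  by (cases x; cases y) (simp add: algebra_simps)

lemma quat_conj_conj: "quat_conj (quat_conj x) = x"
  by (cases x) simp

lemma mult_conj_norm_one_units: "x \<in> norm_one_units \<Longrightarrow> x \<star> quat_conj x = (1, 0, 0, 0)"
  "x \<in> norm_one_units \<Longrightarrow> quat_conj x \<star> x = (1, 0, 0, 0)"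
  using nrd_norm_one_units[of x] by (simp_all add: quat_mult_conj nrd_def del: quat_mult.simps)

lemma letter_inverse: "letter (g, \<not> s) = quat_conj (letter (g, s))"
  by (cases g) (simp_all add: quat_conj_conj)

lemma eval_word_inv: "eval_word (word_inv w) = quat_conj (eval_word w)"
proof (induction w)
  case (Cons l w)
  then show ?case
    by (simp add: eval_word_append eval_word_Cons eval_word_Nil qmul_one quat_conj_mult
        letter_inverse del: quat_mult.simps)
qed (simp add: eval_word_Nil)

lemma range_eval_word: "range eval_word = norm_one_units"
proof
  show "norm_one_units \<subseteq> range eval_word"
  proof (rule norm_one_units_subset_generated)
    show "alpha \<in> range eval_word" "beta \<in> range eval_word"
      by (rule range_eqI[of _ _ "[(Gen_a, True)]"] range_eqI[of _ _ "[(Gen_b, True)]"];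
          simp add: eval_word_Cons eval_word_Nil qmul_one del: quat_mult.simps; fail)+
  qed (auto simp flip: eval_word_append eval_word_inv)
qed (use eval_word_in_norm_one_units in auto)

definition up_to_sign :: "real quat \<Rightarrow> real quat set" where
  "up_to_sign x = {x, quat_smult (- 1) x}"

lemma quat_smult_minus: "quat_smult (- 1) (quat_smult (- 1) x) = x"
  by (cases x) simp

lemma qmul_smult:
  "quat_smult c x \<star> y = quat_smult c (x \<star> y)" "x \<star> quat_smult c y = quat_smult c (x \<star> y)"
  by (cases x; cases y; simp add: algebra_simps)+

lemma up_to_sign_eq_iff: "up_to_sign x = up_to_sign y \<longleftrightarrow> x \<in> up_to_sign y"
  by (auto simp: up_to_sign_def quat_smult_minus)

lemma up_to_sign_mult:
  "x \<in> up_to_sign x' \<Longrightarrow> y \<in> up_to_sign y' \<Longrightarrow> x \<star> y \<in> up_to_sign (x' \<star> y')"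
  by (auto simp: up_to_sign_def qmul_smult quat_smult_minus simp del: quat_mult.simps)

lemma relator_values:
  assumes "r \<in> triangle_relators"
  shows "eval_word r = (- 1, 0, 0, 0)"
proof -
  have a: "alpha \<star> (alpha \<star> alpha) = (- 1, 0, 0, 0)" by (simp add: alpha_def)
  have b: "beta \<star> (beta \<star> beta) = (- 1, 0, 0, 0)"
    by (simp add: beta_def field_simps)
  \<comment> \<open>The square of \<open>\<alpha> \<beta>\<close> has trace \<open>0\<close> and norm \<open>1\<close>.\<close>
  have ab: "alpha \<star> beta = (- sqrt 2 / 2, (2 + sqrt 2) / 6, 1/2, - 1/6)"
    by (simp add: alpha_def beta_def field_simps)
  have ab2: "(alpha \<star> beta) \<star> (alpha \<star> beta) = (0, - (1 + sqrt 2) / 3, - sqrt 2 / 2, sqrt 2 / 6)"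
    unfolding ab by (simp add: field_simps)
  have ab4: "((alpha \<star> beta) \<star> (alpha \<star> beta)) \<star> ((alpha \<star> beta) \<star> (alpha \<star> beta)) = (- 1, 0, 0, 0)"
    unfolding ab2 by (simp add: field_simps)
  from assms show ?thesis
    using a b ab4
    by (auto simp: triangle_relators_def numeral_eq_Suc eval_word_Cons eval_word_Nil qmul_one quat_mult_assoc
        simp del: quat_mult.simps)
qed

lemma eval_word_triangle_eq:
  "triangle_eq u v \<Longrightarrow> up_to_sign (eval_word u) = up_to_sign (eval_word v)"
proof (induction rule: pres_eq.induct)
  case (cancel u g s v)
  have "letter (g, s) \<star> (letter (g, \<not> s) \<star> x) = x" for x
    using letter_in_norm_one_units[of "(g, s)"]
    by (simp add: letter_inverse mult_conj_norm_one_units qmul_one quat_mult_assoc[symmetric] del: quat_mult.simps)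
  then show ?case by (simp add: eval_word_append eval_word_Cons del: quat_mult.simps)
next
  case (relator r u v)
  have "(- 1, 0, 0, 0) \<in> up_to_sign (1, 0, 0, 0)" by (simp add: up_to_sign_def)
  with relator_values[OF relator] have "eval_word r \<in> up_to_sign (1, 0, 0, 0)" by simp
  then have "eval_word u \<star> (eval_word r \<star> eval_word v)
      \<in> up_to_sign (eval_word u \<star> ((1, 0, 0, 0) \<star> eval_word v))"
    by (intro up_to_sign_mult) (auto simp: up_to_sign_def)
  then show ?case
    by (simp add: up_to_sign_eq_iff eval_word_append qmul_one del: quat_mult.simps)
qed auto

text \<open>The simple roots as pure quaternions \<open>\<alpha> j\<close>, \<open>- j\<close> and \<open>j \<beta>\<close>. For a pure quaternion \<open>q\<close> of nonzero
  norm, \<open>v \<mapsto> - q v q\<^sup>-\<^sup>1\<close> is the reflection in \<open>q\<close>. As \<open>(\<alpha> j) j\<^sup>-\<^sup>1 = \<alpha>\<close> and \<open>j\<^sup>-\<^sup>1 (j \<beta>) = \<beta>\<close>, conjugation by \<open>\<alpha>\<close>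
  is the product of the reflections \<open>r\<close> and \<open>s\<close>, and conjugation by \<open>\<beta>\<close> that of \<open>s\<close> and \<open>t\<close>. The signs make the
  mutual products of the three roots proportional to the form \<open>B\<close>.\<close>
fun root_quat :: "real \<times> real \<times> real \<Rightarrow> real quat" where
  "root_quat (x, y, z) =
     (0, sqrt 2 / 3 * z, x / 2 - y + z / 2, x / 2 - (1 + 2 * sqrt 2) / 6 * z)"

lemma inj_root_quat: "inj root_quat"
proof (rule injI)
  fix u v :: "real \<times> real \<times> real" assume "root_quat u = root_quat v"
  then show "u = v" by (cases u; cases v) auto
qed

fun letter_mirrors :: "triangle_gen \<times> bool \<Rightarrow> mirror list" where
  "letter_mirrors (Gen_a, s) = (if s then [Mir_r, Mir_s] else [Mir_s, Mir_r])"
| "letter_mirrors (Gen_b, s) = (if s then [Mir_s, Mir_t] else [Mir_t, Mir_s])"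

lemma letter_root_quat: "letter l \<star> root_quat v = root_quat (act (letter_mirrors l) v) \<star> letter l"
  by (cases l rule: letter.cases; cases v) (simp_all add: alpha_def beta_def field_simps)

definition word_mirrors :: "triangle_gen word \<Rightarrow> mirror list" where
  "word_mirrors w = concat (map letter_mirrors w)"

lemma eval_word_root_quat:
  "eval_word w \<star> root_quat v = root_quat (act (word_mirrors w) v) \<star> eval_word w"
proof (induction w)
  case (Cons l w)
  have "eval_word (l # w) \<star> root_quat v = letter l \<star> (eval_word w \<star> root_quat v)"
    by (simp only: eval_word_Cons quat_mult_assoc)
  also have "\<dots> = (letter l \<star> root_quat (act (word_mirrors w) v)) \<star> eval_word w"
    by (simp only: Cons quat_mult_assoc)
  also have "\<dots> = root_quat (act (word_mirrors (l # w)) v) \<star> eval_word (l # w)"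
    by (simp add: letter_root_quat eval_word_Cons quat_mult_assoc word_mirrors_def del: quat_mult.simps)
  finally show ?case .
qed (simp add: eval_word_Nil word_mirrors_def qmul_one del: quat_mult.simps)

lemma alternate_word_mirrors: "alternate True (word_mirrors w) = w"
proof (induction w)
  case (Cons l w)
  then show ?case
    by (cases l rule: letter.cases) (auto simp: word_mirrors_def)
qed (simp add: word_mirrors_def)

text \<open>A scalar acts trivially by conjugation, so the mirror word has trivial action and is
  equivalent to the empty word. Its alternating product, which is \<open>w\<close> itself, is then trivial in
  the triangle group.\<close>
lemma eval_word_scalar_imp_triangle_eq:
  assumes "eval_word w \<in> up_to_sign (1, 0, 0, 0)"
  shows "triangle_eq w []"
proof -
  have "root_quat (act (word_mirrors w) v) = root_quat v" for v
  proof -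
    have cancel: "x = y" if "quat_smult (- 1) x = quat_smult (- 1) y" for x y :: "real quat"
      using that by (metis quat_smult_minus)
    show ?thesis
      using eval_word_root_quat[of w v] assms
      by (auto simp: up_to_sign_def qmul_smult qmul_one dest!: cancel
          simp del: quat_mult.simps quat_smult.simps)
  qed
  then have "act (word_mirrors w) = id" using inj_root_quat by (auto simp: fun_eq_iff dest: injD)
  then have "mirror_eq (word_mirrors w) []" by (rule trivial_action_imp_mirror_eq_Nil)
  then have "triangle_eq (alternate True (word_mirrors w)) (alternate True [])"
    by (simp add: mirror_eq_def)
  then show ?thesis by (simp add: alternate_word_mirrors)
qed

lemma eval_word_up_to_sign_iff:
  "up_to_sign (eval_word u) = up_to_sign (eval_word v) \<longleftrightarrow> triangle_eq u v"
proof
  assume "up_to_sign (eval_word u) = up_to_sign (eval_word v)"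
  then have "eval_word u \<star> quat_conj (eval_word v) \<in> up_to_sign (eval_word v \<star> quat_conj (eval_word v))"
    by (intro up_to_sign_mult) (auto simp: up_to_sign_def)
  then have "eval_word (u @ word_inv v) \<in> up_to_sign (1, 0, 0, 0)"
    by (simp add: eval_word_append eval_word_inv mult_conj_norm_one_units eval_word_in_norm_one_units del: quat_mult.simps)
  then show "triangle_eq u v"
    using pres_eq_inverseI[OF eval_word_scalar_imp_triangle_eq] by fastforce
qed (rule eval_word_triangle_eq)

section \<open>The unit group and the order in the algebra\<close>

lemma D_B_simps:
  "carrier D_B = K \<times> K \<times> K \<times> K" "x \<otimes>\<^bsub>D_B\<^esub> y = x \<star> y" "\<one>\<^bsub>D_B\<^esub> = (1, 0, 0, 0)"
  "\<zero>\<^bsub>D_B\<^esub> = (0, 0, 0, 0)" "x \<oplus>\<^bsub>D_B\<^esub> y = quat_add x y" "c \<odot>\<^bsub>D_B\<^esub> x = quat_smult c x"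
  by (simp_all add: D_B_def quat_algebra_def)

lemma O_K_subset_K: "x \<in> O_K \<Longrightarrow> x \<in> K"
  unfolding O_K_def K_def by (auto, metis of_rat_of_int_eq)

lemma Q_B_subset_D_B: "Q_B \<subseteq> carrier D_B"
proof
  fix x assume "x \<in> Q_B"
  then obtain c0 c1 c2 c3 where x: "x = order_elt c0 c1 c2 c3"
    and c: "c0 \<in> K" "c1 \<in> K" "c2 \<in> K" "c3 \<in> K"
    unfolding Q_B_eq using O_K_subset_K by blast
  have numeral: "1 \<in> K" "1 / numeral n \<in> K" for n
    using K_closed(1)[of 1] K_closed(1)[of "1 / numeral n"] by (simp_all add: of_rat_divide)
  \<comment> \<open>The basis of the order has denominators \<open>2\<close>, \<open>3\<close> and \<open>6\<close>.\<close>
  have divide: "y / numeral n \<in> K" if "y \<in> K" for y n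
    using K_closed(4)[OF that numeral(2)[of n]] by simp
  show "x \<in> carrier D_B"
    unfolding x D_B_simps order_elt_def
    by (intro SigmaI K_closed divide numeral c)
qed

lemma ominus_D_B:
  assumes "x \<in> carrier D_B"
  shows "\<ominus>\<^bsub>D_B\<^esub> x = quat_smult (- 1) x"
proof (rule abelian_group.minus_equality[OF ring.is_abelian_group[OF ring_D_B] _ assms])
  obtain x0 x1 x2 x3 where x: "x = (x0, x1, x2, x3)" by (cases x)
  show "quat_smult (- 1) x \<oplus>\<^bsub>D_B\<^esub> x = \<zero>\<^bsub>D_B\<^esub>" by (simp add: x D_B_simps)
  show "quat_smult (- 1) x \<in> carrier D_B" using assms by (simp add: x D_B_simps K_closed(5))
qed

lemma norm_one_units_units: "norm_one_units \<subseteq> carrier (units_of D_B)"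
proof
  fix x assume x: "x \<in> norm_one_units"
  then have carrier: "x \<in> carrier D_B" "quat_conj x \<in> carrier D_B"
    using Q_B_subset_D_B norm_one_units_closed(2)[OF x] by (auto simp: norm_one_units_def)
  have "quat_conj x \<otimes>\<^bsub>D_B\<^esub> x = \<one>\<^bsub>D_B\<^esub>" "x \<otimes>\<^bsub>D_B\<^esub> quat_conj x = \<one>\<^bsub>D_B\<^esub>"
    unfolding D_B_simps by (rule mult_conj_norm_one_units[OF x])+
  with carrier show "x \<in> carrier (units_of D_B)"
    unfolding units_of_carrier Units_def by blast
qed

lemma group_units: "group (units_of D_B)"
  using ring.is_monoid[OF ring_D_B] by (rule monoid.units_group)

lemma units_mult: "x \<otimes>\<^bsub>units_of D_B\<^esub> y = x \<star> y" "\<one>\<^bsub>units_of D_B\<^esub> = (1, 0, 0, 0)"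
  by (simp_all add: units_of_mult units_of_one D_B_simps)

lemma inv_norm_one_units:
  assumes "x \<in> norm_one_units"
  shows "inv\<^bsub>units_of D_B\<^esub> x = quat_conj x"
  using assms norm_one_units_units norm_one_units_closed(2)[OF assms]
  by (intro group.inv_equality[OF group_units])
    (auto simp: units_mult mult_conj_norm_one_units simp del: quat_mult.simps)

lemma subgroup_norm_one_units: "subgroup norm_one_units (units_of D_B)"
  using norm_one_units_units one_in_norm_one_units norm_one_units_closed
  by (intro group.subgroupI[OF group_units]) (auto simp: inv_norm_one_units units_mult simp del: quat_mult.simps)

lemma generate_norm_one_units: "generate (units_of D_B) {alpha, beta} = norm_one_units"
proof
  show sub: "generate (units_of D_B) {alpha, beta} \<subseteq> norm_one_units"
    using alpha_beta_norm_one_units by (intro group.generate_subgroup_incl[OF group_units _ subgroup_norm_one_units]) auto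
  show "norm_one_units \<subseteq> generate (units_of D_B) {alpha, beta}"
  proof (rule norm_one_units_subset_generated)
    fix x assume x: "x \<in> generate (units_of D_B) {alpha, beta}"
    then have "inv\<^bsub>units_of D_B\<^esub> x \<in> generate (units_of D_B) {alpha, beta}"
      using alpha_beta_norm_one_units norm_one_units_units by (intro group.generate_m_inv_closed[OF group_units]) auto
    with x sub show "quat_conj x \<in> generate (units_of D_B) {alpha, beta}" by (auto simp: inv_norm_one_units)
  next
    fix x y assume "x \<in> generate (units_of D_B) {alpha, beta}" "y \<in> generate (units_of D_B) {alpha, beta}"
    then show "x \<star> y \<in> generate (units_of D_B) {alpha, beta}"
      using generate.eng by (fastforce simp: units_mult simp del: quat_mult.simps)
  qed (auto intro: generate.incl)
qed

lemma Q_B_linear: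
  assumes "x \<in> Q_B"
  shows "c \<in> O_K \<Longrightarrow> quat_smult c x \<in> Q_B" "y \<in> Q_B \<Longrightarrow> quat_add x y \<in> Q_B"
proof -
  obtain c0 c1 c2 c3 where x: "x = order_elt c0 c1 c2 c3"
    and c: "c0 \<in> O_K" "c1 \<in> O_K" "c2 \<in> O_K" "c3 \<in> O_K"
    using assms by (auto simp: Q_B_eq)
  show "quat_smult c x \<in> Q_B" if "c \<in> O_K"
  proof -
    have "quat_smult c x = order_elt (c * c0) (c * c1) (c * c2) (c * c3)"
      by (simp add: x order_elt_def field_simps)
    also have "\<dots> \<in> Q_B" by (intro order_elt_in_Q_B O_K_closed c that)
    finally show ?thesis .
  qed
  assume "y \<in> Q_B"
  then obtain d0 d1 d2 d3 where y: "y = order_elt d0 d1 d2 d3"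
    and d: "d0 \<in> O_K" "d1 \<in> O_K" "d2 \<in> O_K" "d3 \<in> O_K"
    by (auto simp: Q_B_eq)
  have "quat_add x y = order_elt (c0 + d0) (c1 + d1) (c2 + d2) (c3 + d3)"
    by (simp add: x y order_elt_def field_simps)
  also have "\<dots> \<in> Q_B" by (intro order_elt_in_Q_B O_K_closed c d)
  finally show "quat_add x y \<in> Q_B" .
qed

lemma subring_Q_B: "subring Q_B D_B"
proof (rule ring.subringI[OF ring_D_B Q_B_subset_D_B])
  show "\<one>\<^bsub>D_B\<^esub> \<in> Q_B" using one_in_norm_one_units by (simp add: norm_one_units_def D_B_simps)
  fix x y assume x: "x \<in> Q_B" and "y \<in> Q_B"
  have "- 1 \<in> O_K" by (intro O_K_closed)
  from Q_B_linear(1)[OF x this] show "\<ominus>\<^bsub>D_B\<^esub> x \<in> Q_B"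
    using x Q_B_subset_D_B by (subst ominus_D_B) auto
  show "x \<otimes>\<^bsub>D_B\<^esub> y \<in> Q_B" "x \<oplus>\<^bsub>D_B\<^esub> y \<in> Q_B"
    unfolding D_B_simps using x \<open>y \<in> Q_B\<close> by (rule Q_B_closed Q_B_linear)+
qed

text \<open>From \<open>\<beta> - \<alpha> = (\<surd>2 - 1) \<alpha> \<gamma>\<close>, where \<open>\<surd>2 - 1\<close> has inverse \<open>1 + \<surd>2\<close> and \<open>\<alpha>\<close> has inverse
  \<open>1 - \<alpha>\<close>.\<close>
lemma gamma_eq: "gamma = (\<one>\<^bsub>D_B\<^esub> \<oplus>\<^bsub>D_B\<^esub> (- 1) \<odot>\<^bsub>D_B\<^esub> alpha)
    \<otimes>\<^bsub>D_B\<^esub> ((1 + sqrt 2) \<odot>\<^bsub>D_B\<^esub> (beta \<oplus>\<^bsub>D_B\<^esub> (- 1) \<odot>\<^bsub>D_B\<^esub> alpha))"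
  by (simp add: gamma_def D_B_simps alpha_def beta_def field_simps)

lemma generated_subalgebra_alpha_beta: "generated_subalgebra O_K D_B {alpha, beta} = Q_B"
proof
  show "generated_subalgebra O_K D_B {alpha, beta} \<subseteq> Q_B"
    unfolding generated_subalgebra_def
    using subring_Q_B alpha_beta_norm_one_units by (intro Inter_lower) (auto simp: norm_one_units_def D_B_simps intro: Q_B_linear)
  show "Q_B \<subseteq> generated_subalgebra O_K D_B {alpha, beta}"
    unfolding generated_subalgebra_def
  proof (intro Inter_greatest)
    fix V assume "V \<in> {V. subring V D_B \<and> (\<forall>c\<in>O_K. \<forall>v\<in>V. c \<odot>\<^bsub>D_B\<^esub> v \<in> V) \<and> {alpha, beta} \<subseteq> V}"
    then have V: "subring V D_B" and smult: "\<And>c v. c \<in> O_K \<Longrightarrow> v \<in> V \<Longrightarrow> c \<odot>\<^bsub>D_B\<^esub> v \<in> V"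
      and gens: "alpha \<in> V" "beta \<in> V" by auto
    note closed = subringE(3,6,7)[OF V]
    have gamma: "gamma \<in> V"
      unfolding gamma_eq by (intro closed smult gens O_K_closed)
    have "alpha0 = alpha" by (simp add: alpha0_def alpha_def D_B_simps)
    then have alpha0: "alpha0 \<in> V" using gens by simp
    show "Q_B \<subseteq> V"
    proof
      fix x assume "x \<in> Q_B"
      then obtain c0 c1 c2 c3 where c: "c0 \<in> O_K" "c1 \<in> O_K" "c2 \<in> O_K" "c3 \<in> O_K"
        and x: "x = c0 \<odot>\<^bsub>D_B\<^esub> \<one>\<^bsub>D_B\<^esub> \<oplus>\<^bsub>D_B\<^esub> c1 \<odot>\<^bsub>D_B\<^esub> alpha0
          \<oplus>\<^bsub>D_B\<^esub> c2 \<odot>\<^bsub>D_B\<^esub> gamma \<oplus>\<^bsub>D_B\<^esub> c3 \<odot>\<^bsub>D_B\<^esub> (alpha0 \<otimes>\<^bsub>D_B\<^esub> gamma)"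
        unfolding Q_B_def by auto
      show "x \<in> V" unfolding x by (intro closed smult alpha0 gamma c)
    qed
  qed
qed

section \<open>The isomorphism with the triangle group\<close>

lemma carrier_Q_B1: "carrier Q_B1 = norm_one_units"
  by (simp add: Q_B1_def norm_one_units_def)

lemma Q_B1_mult: "x \<otimes>\<^bsub>Q_B1\<^esub> y = x \<star> y"
  by (simp add: Q_B1_def units_mult del: quat_mult.simps)

lemma coset_up_to_sign: "{\<one>\<^bsub>D_B\<^esub>, \<ominus>\<^bsub>D_B\<^esub> \<one>\<^bsub>D_B\<^esub>} #>\<^bsub>Q_B1\<^esub> x = up_to_sign x"
proof -
  have "\<ominus>\<^bsub>D_B\<^esub> \<one>\<^bsub>D_B\<^esub> = quat_smult (- 1) (1, 0, 0, 0)"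
    using ring.ring_simprules(6)[OF ring_D_B] by (simp add: ominus_D_B D_B_simps)
  then show ?thesis
    by (auto simp: r_coset_def up_to_sign_def Q_B1_mult D_B_simps qmul_smult qmul_one
        simp del: quat_mult.simps quat_smult.simps)
qed

lemma up_to_sign_set_mult: "up_to_sign x <#>\<^bsub>Q_B1\<^esub> up_to_sign y = up_to_sign (x \<star> y)"
  by (auto simp: set_mult_def up_to_sign_def Q_B1_mult qmul_smult quat_smult_minus
      simp del: quat_mult.simps quat_smult.simps)

definition word_class_value :: "triangle_gen word set \<Rightarrow> real quat set" where
  "word_class_value X = (\<Union>w\<in>X. up_to_sign (eval_word w))"

lemma triangle_group_iso:
  "triangle_group 3 3 4 \<cong> Q_B1 Mod {\<one>\<^bsub>D_B\<^esub>, \<ominus>\<^bsub>D_B\<^esub> \<one>\<^bsub>D_B\<^esub>}"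
proof -
  let ?N = "{\<one>\<^bsub>D_B\<^esub>, \<ominus>\<^bsub>D_B\<^esub> \<one>\<^bsub>D_B\<^esub>}"
  have class_value: "word_class_value (pres_rel triangle_relators `` {w}) = up_to_sign (eval_word w)" for w
  proof -
    have "w \<in> pres_rel triangle_relators `` {w}" by (simp add: pres_rel_def pres_eq.refl)
    moreover have "up_to_sign (eval_word v) = up_to_sign (eval_word w)" if "v \<in> pres_rel triangle_relators `` {w}" for v
      using that eval_word_triangle_eq[of w v] by (simp add: pres_rel_def)
    ultimately show ?thesis unfolding word_class_value_def by blast
  qed
  have target: "carrier (Q_B1 Mod ?N) = up_to_sign ` norm_one_units"
    unfolding FactGroup_def RCOSETS_def partial_object.simps carrier_Q_B1 coset_up_to_sign by auto
  have source: "carrier (triangle_group 3 3 4) = range (\<lambda>w. pres_rel triangle_relators `` {w})"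
    by (auto simp: triangle_group_eq presented_group_def quotient_def)
  have "word_class_value \<in> hom (triangle_group 3 3 4) (Q_B1 Mod ?N)"
  proof (rule homI)
    fix X Y assume "X \<in> carrier (triangle_group 3 3 4)" "Y \<in> carrier (triangle_group 3 3 4)"
    then obtain u v where X: "X = pres_rel triangle_relators `` {u}" and Y: "Y = pres_rel triangle_relators `` {v}"
      unfolding source by blast
    have "X \<otimes>\<^bsub>triangle_group 3 3 4\<^esub> Y = pres_rel triangle_relators `` {u @ v}"
      unfolding X Y triangle_group_eq by (rule presented_group_mult)
    then show "word_class_value (X \<otimes>\<^bsub>triangle_group 3 3 4\<^esub> Y)
        = word_class_value X \<otimes>\<^bsub>Q_B1 Mod ?N\<^esub> word_class_value Y"
      by (simp only: X Y class_value eval_word_append FactGroup_def monoid.simps up_to_sign_set_mult)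
  qed (use target source class_value eval_word_in_norm_one_units in auto)
  moreover have "bij_betw word_class_value (carrier (triangle_group 3 3 4)) (carrier (Q_B1 Mod ?N))"
  proof (rule bij_betwI')
    fix X Y assume "X \<in> carrier (triangle_group 3 3 4)" "Y \<in> carrier (triangle_group 3 3 4)"
    then obtain u v where X: "X = pres_rel triangle_relators `` {u}" and Y: "Y = pres_rel triangle_relators `` {v}"
      unfolding source by blast
    show "word_class_value X = word_class_value Y \<longleftrightarrow> X = Y"
      unfolding X Y class_value eval_word_up_to_sign_iff eq_equiv_class_iff[OF equiv_pres_rel UNIV_I UNIV_I]
      by (simp add: pres_rel_def)
  next
    fix Z assume "Z \<in> carrier (Q_B1 Mod ?N)"
    then obtain w where "Z = up_to_sign (eval_word w)"
      unfolding target range_eval_word[symmetric] by auto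
    then show "\<exists>X\<in>carrier (triangle_group 3 3 4). Z = word_class_value X"
      unfolding source by (intro bexI[of _ "pres_rel triangle_relators `` {w}"]) (simp_all add: class_value)
  qed (use target source class_value eval_word_in_norm_one_units in auto)
  ultimately show ?thesis unfolding is_iso_def iso_def by blast
qed

theorem theorem1p4:
  shows "\<exists>\<alpha>\<in>carrier D_B. \<exists>\<beta>\<in>carrier D_B.
    nrd \<alpha> = 1 \<and> nrd \<beta> = 1 \<and>
    Q_B = generated_subalgebra O_K D_B {\<alpha>, \<beta>} \<and>
    carrier Q_B1 = generate (units_of D_B) {\<alpha>, \<beta>} \<and>
    Q_B1 Mod {\<one>\<^bsub>D_B\<^esub>, \<ominus>\<^bsub>D_B\<^esub> \<one>\<^bsub>D_B\<^esub>} \<cong> triangle_group 3 3 4"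
proof (rule bexI[of _ alpha], rule bexI[of _ beta], intro conjI)
  show "alpha \<in> carrier D_B" "beta \<in> carrier D_B"
    using alpha_beta_norm_one_units Q_B_subset_D_B by (auto simp: norm_one_units_def)
  show "nrd alpha = 1" "nrd beta = 1" by (rule nrd_alpha nrd_beta)+
  show "Q_B = generated_subalgebra O_K D_B {alpha, beta}"
    by (rule generated_subalgebra_alpha_beta[symmetric])
  show "carrier Q_B1 = generate (units_of D_B) {alpha, beta}"
    by (simp only: carrier_Q_B1 generate_norm_one_units)
  have "group (triangle_group 3 3 4)"
    unfolding triangle_group_eq by (rule group_presented_group)
  from group.iso_sym[OF this triangle_group_iso]
  show "Q_B1 Mod {\<one>\<^bsub>D_B\<^esub>, \<ominus>\<^bsub>D_B\<^esub> \<one>\<^bsub>D_B\<^esub>} \<cong> triangle_group 3 3 4" .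
qed

end
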